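(* Assume that $N$ is odd. Then $H_\lambda$ is a spherical Hopf algebra, with pivot $\omega=g_1^N$.
   Context: $\Bbbk$ is an algebraically closed field of characteristic zero, $N,M\ge2$ are integers, $\lambda=(\lambda_1,\lambda_2,\lambda_3)\in\Bbbk^3$, $\Gamma=\langle g_1,g_2: g_1g_2=g_2g_1,\ g_1^{2N}=g_2^{2M}=1\rangle$. $H_\lambda$ is the algebra generated by $\Gamma$ and $a_1,a_2$ with relations $g_1a_1=-a_1g_1$, $g_1a_2=-a_2g_1$, $g_2a_1=a_1g_2$, $g_2a_2=-a_2g_2$, $a_1^2=\lambda_1(1-g_1^2)$, $a_2^2=\lambda_2(1-g_2^2)$, $a_1a_2a_1a_2+a_2a_1a_2a_1=\lambda_3(1-g_1^2g_2^2)-2\lambda_1\lambda_2(1+g_2^2)(1-g_1^2)$. It is a Hopf algebra with $g_1,g_2$ group-like and $\Delta(a_i)=a_i\otimes1+g_i\otimes a_i$, $i=1,2$; $S$ denotes the antipode. A spherical Hopf algebra is a pair $(H,\omega)$ with $H$ a Hopf algebra and $\omega\in H$ a group-like element such that (a) $S^2(x)=\omega x\omega^{-1}$ for all $x\in H$ (such $\omega$ is called a pivot), and (b) $\operatorname{tr}_V(\theta\omega)=\operatorname{tr}_V(\theta\omega^{-1})$ for every finite-dimensional $H$-module $V$ and every $\theta\in\operatorname{End}_H(V)$. *)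

theory Defs
  imports
    "HOL-Library.Poly_Mapping"
    "HOL-Algebra.QuotRing"
    "HOL-Algebra.Algebraic_Closure_Type"
begin

section \<open>Algebras over a field\<close>

text \<open>
  The ground field is the type \<open>'k\<close>; vector spaces and algebras over it are records in the
  style of HOL-Algebra.  For vector spaces only the additive part and the scalar
  multiplication of the record are used.  The locale \<open>algebra\<close> of HOL-Algebra is restricted to
  commutative algebras, hence the separate locale below.
\<close>

abbreviation (input) ground :: "'k::field ring"
  where "ground \<equiv> ring_of_type_algebra"

locale assoc_algebra =
  Module.module "ground :: 'k ring" A + ring A
  for A :: "('k::field, 'a, 'm) module_scheme" (structure) +
  assumes smult_mult_left:
      "\<lbrakk>x \<in> carrier A; y \<in> carrier A\<rbrakk> \<Longrightarrow> (c \<odot> x) \<otimes> y = c \<odot> (x \<otimes> y)"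
    and smult_mult_right:
      "\<lbrakk>x \<in> carrier A; y \<in> carrier A\<rbrakk> \<Longrightarrow> x \<otimes> (c \<odot> y) = c \<odot> (x \<otimes> y)"

definition linear_maps ::
    "('k::field, 'a, 'm) module_scheme \<Rightarrow> ('k, 'b, 'n) module_scheme \<Rightarrow> ('a \<Rightarrow> 'b) set"
  where "linear_maps V W = {f \<in> carrier V \<rightarrow> carrier W.
    (\<forall>x\<in>carrier V. \<forall>y\<in>carrier V. f (x \<oplus>\<^bsub>V\<^esub> y) = f x \<oplus>\<^bsub>W\<^esub> f y) \<and>
    (\<forall>c. \<forall>x\<in>carrier V. f (c \<odot>\<^bsub>V\<^esub> x) = c \<odot>\<^bsub>W\<^esub> f x)}"

definition algebra_homs ::
    "('k::field, 'a, 'm) module_scheme \<Rightarrow> ('k, 'b, 'n) module_scheme \<Rightarrow> ('a \<Rightarrow> 'b) set"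
  where "algebra_homs A B = linear_maps A B \<inter> ring_hom A B"

definition base_algebra :: "('k::field, 'k) module"
  where "base_algebra =
    \<lparr>carrier = UNIV, monoid.mult = (*), one = 1, ring.zero = 0, add = (+), module.smult = (*)\<rparr>"

definition opposite_algebra :: "('k::field, 'a, 'm) module_scheme \<Rightarrow> ('k, 'a, 'm) module_scheme"
  where "opposite_algebra A = A\<lparr>monoid.mult := (\<lambda>x y. y \<otimes>\<^bsub>A\<^esub> x)\<rparr>"

definition monoid_algebra :: "('g, 'm) monoid_scheme \<Rightarrow> ('k::field, 'g \<Rightarrow>\<^sub>0 'k) module"
  where "monoid_algebra G =
    \<lparr>carrier = {p. Poly_Mapping.keys p \<subseteq> carrier G},
     monoid.mult = (\<lambda>p q. \<Sum>x\<in>Poly_Mapping.keys p. \<Sum>y\<in>Poly_Mapping.keys q.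
       Poly_Mapping.single (x \<otimes>\<^bsub>G\<^esub> y) (Poly_Mapping.lookup p x * Poly_Mapping.lookup q y)),
     one = Poly_Mapping.single \<one>\<^bsub>G\<^esub> 1,
     ring.zero = 0,
     add = (+),
     module.smult = (\<lambda>c. Poly_Mapping.map ((*) c))\<rparr>"

text \<open>The ring \<open>A Quot I\<close> together with its scalar multiplication.\<close>

definition quotient_algebra ::
    "('k::field, 'a, 'm) module_scheme \<Rightarrow> 'a set \<Rightarrow> ('k, 'a set) module"
  where "quotient_algebra A I =
    \<lparr>carrier = carrier (A Quot I),
     monoid.mult = monoid.mult (A Quot I),
     one = \<one>\<^bsub>A Quot I\<^esub>,
     ring.zero = \<zero>\<^bsub>A Quot I\<^esub>,
     add = add (A Quot I),
     module.smult = (\<lambda>c Y. \<Union>x\<in>Y. I +>\<^bsub>A\<^esub> (c \<odot>\<^bsub>A\<^esub> x))\<rparr>"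

text \<open>
  The map on cosets induced by \<open>f\<close>; meaningful when \<open>f\<close> is constant on cosets, as in
  HOL-Algebra's isomorphism theorems.
\<close>

definition induced_map :: "('a \<Rightarrow> 'b) \<Rightarrow> 'a set \<Rightarrow> 'b"
  where "induced_map f Y = the_elem (f ` Y)"

definition linear_extension ::
    "('k::field, 'b, 'm) module_scheme \<Rightarrow> ('x \<Rightarrow> 'b) \<Rightarrow> ('x \<Rightarrow>\<^sub>0 'k) \<Rightarrow> 'b"
  where "linear_extension B f p =
    (\<Oplus>\<^bsub>B\<^esub>x\<in>Poly_Mapping.keys p. Poly_Mapping.lookup p x \<odot>\<^bsub>B\<^esub> f x)"


section \<open>Tensor products\<close>

text \<open>
  \<open>A \<otimes> B\<close> is the vector space with basis \<open>carrier A \<times> carrier B\<close> modulo the subspace spanned by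
  the bilinearity relations.  That subspace is an ideal of the monoid algebra of \<open>A \<times>\<times> B\<close>, so
  the quotient carries the product \<open>(a \<otimes> b) (a' \<otimes> b') = a a' \<otimes> b b'\<close>.
\<close>

definition bilinearity_relators ::
    "('k::field, 'a, 'm) module_scheme \<Rightarrow> ('k, 'b, 'n) module_scheme \<Rightarrow> ('a \<times> 'b \<Rightarrow>\<^sub>0 'k) set"
  where "bilinearity_relators A B =
    {Poly_Mapping.single (x \<oplus>\<^bsub>A\<^esub> x', y) 1
       - Poly_Mapping.single (x, y) 1 - Poly_Mapping.single (x', y) 1 | x x' y.
       x \<in> carrier A \<and> x' \<in> carrier A \<and> y \<in> carrier B} \<union>
    {Poly_Mapping.single (x, y \<oplus>\<^bsub>B\<^esub> y') 1
       - Poly_Mapping.single (x, y) 1 - Poly_Mapping.single (x, y') 1 | x y y'.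
       x \<in> carrier A \<and> y \<in> carrier B \<and> y' \<in> carrier B} \<union>
    {Poly_Mapping.single (c \<odot>\<^bsub>A\<^esub> x, y) 1 - Poly_Mapping.single (x, y) c | c x y.
       x \<in> carrier A \<and> y \<in> carrier B} \<union>
    {Poly_Mapping.single (x, c \<odot>\<^bsub>B\<^esub> y) 1 - Poly_Mapping.single (x, y) c | c x y.
       x \<in> carrier A \<and> y \<in> carrier B}"

definition bilinearity_subspace ::
    "('k::field, 'a, 'm) module_scheme \<Rightarrow> ('k, 'b, 'n) module_scheme \<Rightarrow> ('a \<times> 'b \<Rightarrow>\<^sub>0 'k) set"
  where "bilinearity_subspace A B =
    module.span (\<lambda>c. Poly_Mapping.map ((*) c)) (bilinearity_relators A B)"

definition tensor ::
    "('k::field, 'a, 'm) module_scheme \<Rightarrow> ('k, 'b, 'n) module_scheme \<Rightarrow>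
     ('k, ('a \<times> 'b \<Rightarrow>\<^sub>0 'k) set) module"
  where "tensor A B =
    quotient_algebra (monoid_algebra (A \<times>\<times> B)) (bilinearity_subspace A B)"

definition pure_tensor ::
    "('k::field, 'a, 'm) module_scheme \<Rightarrow> ('k, 'b, 'n) module_scheme \<Rightarrow>
     'a \<Rightarrow> 'b \<Rightarrow> ('a \<times> 'b \<Rightarrow>\<^sub>0 'k) set"
  where "pure_tensor A B x y =
    bilinearity_subspace A B
      +>\<^bsub>monoid_algebra (A \<times>\<times> B) :: ('k, 'a \<times> 'b \<Rightarrow>\<^sub>0 'k) module\<^esub> Poly_Mapping.single (x, y) 1"

text \<open>The linear map \<open>a \<otimes> b \<mapsto> \<beta> a b\<close> into \<open>C\<close> determined by a bilinear map \<open>\<beta>\<close>.\<close>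

definition tensor_lift ::
    "('k::field, 'c, 'm) module_scheme \<Rightarrow> ('a \<Rightarrow> 'b \<Rightarrow> 'c) \<Rightarrow> ('a \<times> 'b \<Rightarrow>\<^sub>0 'k) set \<Rightarrow> 'c"
  where "tensor_lift C \<beta> = induced_map (linear_extension C (\<lambda>(a, b). \<beta> a b))"

text \<open>\<open>tensor_map C D f g\<close> is \<open>f \<otimes> g\<close> for linear maps \<open>f\<close> into \<open>C\<close> and \<open>g\<close> into \<open>D\<close>.\<close>

definition tensor_map ::
    "('k::field, 'c, 'm) module_scheme \<Rightarrow> ('k, 'd, 'n) module_scheme \<Rightarrow> ('a \<Rightarrow> 'c) \<Rightarrow> ('b \<Rightarrow> 'd) \<Rightarrow>
     ('a \<times> 'b \<Rightarrow>\<^sub>0 'k) set \<Rightarrow> ('c \<times> 'd \<Rightarrow>\<^sub>0 'k) set"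
  where "tensor_map C D f g = tensor_lift (tensor C D) (\<lambda>a b. pure_tensor C D (f a) (g b))"

text \<open>The canonical map \<open>(A \<otimes> A) \<otimes> A \<rightarrow> A \<otimes> (A \<otimes> A)\<close>.\<close>

definition tensor_assoc ::
    "('k::field, 'a, 'm) module_scheme \<Rightarrow>
     (('a \<times> 'a \<Rightarrow>\<^sub>0 'k) set \<times> 'a \<Rightarrow>\<^sub>0 'k) set \<Rightarrow> ('a \<times> ('a \<times> 'a \<Rightarrow>\<^sub>0 'k) set \<Rightarrow>\<^sub>0 'k) set"
  where "tensor_assoc A =
    tensor_lift (tensor A (tensor A A)) (\<lambda>t c.
      tensor_lift (tensor A (tensor A A)) (\<lambda>a b.
        pure_tensor A (tensor A A) a (pure_tensor A A b c)) t)"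


section \<open>Hopf algebras\<close>

record (overloaded) ('k::field, 'a) hopf = "('k, 'a) module" +
  comult :: "'a \<Rightarrow> ('a \<times> 'a \<Rightarrow>\<^sub>0 'k) set"
  counit :: "'a \<Rightarrow> 'k"
  antipode :: "'a \<Rightarrow> 'a"

locale hopf_algebra = assoc_algebra H
  for H :: "('k::field, 'a, 'm) hopf_scheme" (structure) +
  assumes comult_hom: "comult H \<in> algebra_homs H (tensor H H)"
    and counit_hom: "counit H \<in> algebra_homs H base_algebra"
    and coassoc: "x \<in> carrier H \<Longrightarrow>
      tensor_assoc H (tensor_map (tensor H H) H (comult H) (\<lambda>a. a) (comult H x)) =
      tensor_map H (tensor H H) (\<lambda>a. a) (comult H) (comult H x)"
    and counit_left: "x \<in> carrier H \<Longrightarrow> tensor_lift H (\<lambda>a b. counit H a \<odot> b) (comult H x) = x"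
    and counit_right: "x \<in> carrier H \<Longrightarrow> tensor_lift H (\<lambda>a b. counit H b \<odot> a) (comult H x) = x"
    and antipode_linear: "antipode H \<in> linear_maps H H"
    and antipode_left: "x \<in> carrier H \<Longrightarrow>
      tensor_lift H (\<lambda>a b. antipode H a \<otimes> b) (comult H x) = counit H x \<odot> \<one>"
    and antipode_right: "x \<in> carrier H \<Longrightarrow>
      tensor_lift H (\<lambda>a b. a \<otimes> antipode H b) (comult H x) = counit H x \<odot> \<one>"

definition group_like :: "('k::field, 'a, 'm) hopf_scheme \<Rightarrow> 'a \<Rightarrow> bool"
  where "group_like H w \<longleftrightarrow>
    w \<in> carrier H \<and> comult H w = pure_tensor H H w w \<and> counit H w = 1"

definition pivot :: "('k::field, 'a, 'm) hopf_scheme \<Rightarrow> 'a \<Rightarrow> bool"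
  where "pivot H w \<longleftrightarrow> group_like H w \<and>
    (\<forall>x\<in>carrier H. antipode H (antipode H x) = w \<otimes>\<^bsub>H\<^esub> x \<otimes>\<^bsub>H\<^esub> inv\<^bsub>H\<^esub> w)"


section \<open>Modules and traces\<close>

definition finite_basis :: "('k::field, 'v, 'm) module_scheme \<Rightarrow> 'v set \<Rightarrow> bool"
  where "finite_basis V B \<longleftrightarrow> finite B \<and> B \<subseteq> carrier V \<and>
    (\<forall>v\<in>carrier V. \<exists>!c. c \<in> B \<rightarrow>\<^sub>E UNIV \<and> v = (\<Oplus>\<^bsub>V\<^esub>b\<in>B. c b \<odot>\<^bsub>V\<^esub> b))"

definition finite_dimensional :: "('k::field, 'v, 'm) module_scheme \<Rightarrow> bool"
  where "finite_dimensional V \<longleftrightarrow> (\<exists>B. finite_basis V B)"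

definition coordinates :: "('k::field, 'v, 'm) module_scheme \<Rightarrow> 'v set \<Rightarrow> 'v \<Rightarrow> 'v \<Rightarrow> 'k"
  where "coordinates V B v =
    (THE c. c \<in> B \<rightarrow>\<^sub>E UNIV \<and> v = (\<Oplus>\<^bsub>V\<^esub>b\<in>B. c b \<odot>\<^bsub>V\<^esub> b))"

definition trace :: "('k::field, 'v, 'm) module_scheme \<Rightarrow> ('v \<Rightarrow> 'v) \<Rightarrow> 'k"
  where "trace V f =
    (let B = (SOME B. finite_basis V B) in \<Sum>b\<in>B. coordinates V B (f b) b)"

locale algebra_module =
  A: assoc_algebra A + V: Module.module "ground :: 'k ring" V
  for A :: "('k::field, 'a, 'm) module_scheme" (structure)
    and V :: "('k, 'v, 'n) module_scheme" +
  fixes act :: "'a \<Rightarrow> 'v \<Rightarrow> 'v"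
  assumes act_linear: "h \<in> carrier A \<Longrightarrow> act h \<in> linear_maps V V"
    and act_add: "\<lbrakk>h \<in> carrier A; h' \<in> carrier A; v \<in> carrier V\<rbrakk> \<Longrightarrow>
      act (h \<oplus> h') v = act h v \<oplus>\<^bsub>V\<^esub> act h' v"
    and act_smult: "\<lbrakk>h \<in> carrier A; v \<in> carrier V\<rbrakk> \<Longrightarrow>
      act (c \<odot> h) v = c \<odot>\<^bsub>V\<^esub> act h v"
    and act_mult: "\<lbrakk>h \<in> carrier A; h' \<in> carrier A; v \<in> carrier V\<rbrakk> \<Longrightarrow>
      act (h \<otimes> h') v = act h (act h' v)"
    and act_one: "v \<in> carrier V \<Longrightarrow> act \<one> v = v"

definition module_endos ::
    "('k::field, 'a, 'm) module_scheme \<Rightarrow> ('k, 'v, 'n) module_scheme \<Rightarrow> ('a \<Rightarrow> 'v \<Rightarrow> 'v) \<Rightarrow>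
     ('v \<Rightarrow> 'v) set"
  where "module_endos A V act = {f \<in> linear_maps V V.
    \<forall>h\<in>carrier A. \<forall>v\<in>carrier V. f (act h v) = act h (f v)}"

text \<open>
  A definition cannot quantify over types, so the type \<open>'v\<close> in which the carriers of the modules
  live is a parameter; a statement about all finite-dimensional modules is one polymorphic in
  \<open>'v\<close>.
\<close>

definition spherical_hopf_algebra ::
    "'v itself \<Rightarrow> ('k::field, 'a, 'm) hopf_scheme \<Rightarrow> 'a \<Rightarrow> bool"
  where "spherical_hopf_algebra T H w \<longleftrightarrow>
    hopf_algebra H \<and> pivot H w \<and>
    (\<forall>(V :: ('k, 'v) module) act. algebra_module H V act \<and> finite_dimensional V \<longrightarrow>
      (\<forall>f\<in>module_endos H V act. trace V (f \<circ> act w) = trace V (f \<circ> act (inv\<^bsub>H\<^esub> w))))"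


section \<open>The Hopf algebras \<open>H\<^sub>\<lambda>\<close>\<close>

datatype gen = G1 | G2 | A1 | A2

definition free_algebra :: "('k::field, 'x list \<Rightarrow>\<^sub>0 'k) module"
  where "free_algebra = monoid_algebra \<lparr>carrier = UNIV, monoid.mult = (@), one = []\<rparr>"

definition free_gen :: "'x \<Rightarrow> 'x list \<Rightarrow>\<^sub>0 'k::field"
  where "free_gen x = Poly_Mapping.single [x] 1"

text \<open>The algebra map from the free algebra to \<open>B\<close> extending \<open>f\<close>.\<close>

definition free_lift ::
    "('k::field, 'b, 'm) module_scheme \<Rightarrow> ('x \<Rightarrow> 'b) \<Rightarrow> ('x list \<Rightarrow>\<^sub>0 'k) \<Rightarrow> 'b"
  where "free_lift B f =
    linear_extension B (\<lambda>w. foldr (\<lambda>x b. f x \<otimes>\<^bsub>B\<^esub> b) w \<one>\<^bsub>B\<^esub>)"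

text \<open>
  A pair \<open>(l, r)\<close> stands for the relation \<open>l = r\<close>.  The first three relations present the
  group \<open>\<Gamma>\<close>, the inverses of \<open>g\<^sub>1\<close> and \<open>g\<^sub>2\<close> being \<open>g\<^sub>1\<^sup>2\<^sup>N\<^sup>-\<^sup>1\<close> and \<open>g\<^sub>2\<^sup>2\<^sup>M\<^sup>-\<^sup>1\<close>.
\<close>

definition H_relations ::
    "nat \<Rightarrow> nat \<Rightarrow> 'k::field \<Rightarrow> 'k \<Rightarrow> 'k \<Rightarrow> ((gen list \<Rightarrow>\<^sub>0 'k) \<times> (gen list \<Rightarrow>\<^sub>0 'k)) set"
  where "H_relations N M l1 l2 l3 =
   (let F = (free_algebra :: ('k, gen list \<Rightarrow>\<^sub>0 'k) module);
        g1 = free_gen G1; g2 = free_gen G2; a1 = free_gen A1; a2 = free_gen A2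
    in {(g1 \<otimes>\<^bsub>F\<^esub> g2, g2 \<otimes>\<^bsub>F\<^esub> g1),
        (g1 [^]\<^bsub>F\<^esub> (2 * N), \<one>\<^bsub>F\<^esub>),
        (g2 [^]\<^bsub>F\<^esub> (2 * M), \<one>\<^bsub>F\<^esub>),
        (g1 \<otimes>\<^bsub>F\<^esub> a1, \<ominus>\<^bsub>F\<^esub> (a1 \<otimes>\<^bsub>F\<^esub> g1)),
        (g1 \<otimes>\<^bsub>F\<^esub> a2, \<ominus>\<^bsub>F\<^esub> (a2 \<otimes>\<^bsub>F\<^esub> g1)),
        (g2 \<otimes>\<^bsub>F\<^esub> a1, a1 \<otimes>\<^bsub>F\<^esub> g2),
        (g2 \<otimes>\<^bsub>F\<^esub> a2, \<ominus>\<^bsub>F\<^esub> (a2 \<otimes>\<^bsub>F\<^esub> g2)),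
        (a1 [^]\<^bsub>F\<^esub> (2::nat), l1 \<odot>\<^bsub>F\<^esub> (\<one>\<^bsub>F\<^esub> \<ominus>\<^bsub>F\<^esub> g1 [^]\<^bsub>F\<^esub> (2::nat))),
        (a2 [^]\<^bsub>F\<^esub> (2::nat), l2 \<odot>\<^bsub>F\<^esub> (\<one>\<^bsub>F\<^esub> \<ominus>\<^bsub>F\<^esub> g2 [^]\<^bsub>F\<^esub> (2::nat))),
        (a1 \<otimes>\<^bsub>F\<^esub> a2 \<otimes>\<^bsub>F\<^esub> a1 \<otimes>\<^bsub>F\<^esub> a2 \<oplus>\<^bsub>F\<^esub> a2 \<otimes>\<^bsub>F\<^esub> a1 \<otimes>\<^bsub>F\<^esub> a2 \<otimes>\<^bsub>F\<^esub> a1,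
         l3 \<odot>\<^bsub>F\<^esub> (\<one>\<^bsub>F\<^esub> \<ominus>\<^bsub>F\<^esub> g1 [^]\<^bsub>F\<^esub> (2::nat) \<otimes>\<^bsub>F\<^esub> g2 [^]\<^bsub>F\<^esub> (2::nat)) \<ominus>\<^bsub>F\<^esub>
         (2 * l1 * l2) \<odot>\<^bsub>F\<^esub> ((\<one>\<^bsub>F\<^esub> \<oplus>\<^bsub>F\<^esub> g2 [^]\<^bsub>F\<^esub> (2::nat)) \<otimes>\<^bsub>F\<^esub>
                            (\<one>\<^bsub>F\<^esub> \<ominus>\<^bsub>F\<^esub> g1 [^]\<^bsub>F\<^esub> (2::nat))))})"

definition H_ideal :: "nat \<Rightarrow> nat \<Rightarrow> 'k::field \<Rightarrow> 'k \<Rightarrow> 'k \<Rightarrow> (gen list \<Rightarrow>\<^sub>0 'k) set"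
  where "H_ideal N M l1 l2 l3 =
    genideal (free_algebra :: ('k, gen list \<Rightarrow>\<^sub>0 'k) module)
      {l \<ominus>\<^bsub>(free_algebra :: ('k, gen list \<Rightarrow>\<^sub>0 'k) module)\<^esub> r | l r. (l, r) \<in> H_relations N M l1 l2 l3}"

definition H_alg :: "nat \<Rightarrow> nat \<Rightarrow> 'k::field \<Rightarrow> 'k \<Rightarrow> 'k \<Rightarrow> ('k, (gen list \<Rightarrow>\<^sub>0 'k) set) module"
  where "H_alg N M l1 l2 l3 = quotient_algebra free_algebra (H_ideal N M l1 l2 l3)"

definition H_gen ::
    "nat \<Rightarrow> nat \<Rightarrow> 'k::field \<Rightarrow> 'k \<Rightarrow> 'k \<Rightarrow> gen \<Rightarrow> (gen list \<Rightarrow>\<^sub>0 'k) set"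
  where "H_gen N M l1 l2 l3 x =
    H_ideal N M l1 l2 l3 +>\<^bsub>(free_algebra :: ('k, gen list \<Rightarrow>\<^sub>0 'k) module)\<^esub> free_gen x"

text \<open>
  The comultiplication, counit and antipode are induced by the algebra maps from the free
  algebra to \<open>H \<otimes> H\<close>, to the ground field and to the opposite algebra of \<open>H\<close> with the values
  below on generators.  The values of the counit and of the antipode are forced by those of
  the comultiplication.
\<close>

definition H_lambda ::
    "nat \<Rightarrow> nat \<Rightarrow> 'k::field \<Rightarrow> 'k \<Rightarrow> 'k \<Rightarrow> ('k, (gen list \<Rightarrow>\<^sub>0 'k) set) hopf"
  where "H_lambda N M l1 l2 l3 =
   (let A = H_alg N M l1 l2 l3;
        g1 = H_gen N M l1 l2 l3 G1; g2 = H_gen N M l1 l2 l3 G2;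
        a1 = H_gen N M l1 l2 l3 A1; a2 = H_gen N M l1 l2 l3 A2
    in \<lparr>carrier = carrier A, monoid.mult = monoid.mult A, one = \<one>\<^bsub>A\<^esub>,
        ring.zero = \<zero>\<^bsub>A\<^esub>, add = add A, module.smult = module.smult A,
        comult = induced_map (free_lift (tensor A A) (\<lambda>x. case x of
            G1 \<Rightarrow> pure_tensor A A g1 g1
          | G2 \<Rightarrow> pure_tensor A A g2 g2
          | A1 \<Rightarrow> pure_tensor A A a1 \<one>\<^bsub>A\<^esub> \<oplus>\<^bsub>tensor A A\<^esub> pure_tensor A A g1 a1
          | A2 \<Rightarrow> pure_tensor A A a2 \<one>\<^bsub>A\<^esub> \<oplus>\<^bsub>tensor A A\<^esub> pure_tensor A A g2 a2)),
        counit = induced_map (free_lift base_algebra (\<lambda>x. case x of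
            G1 \<Rightarrow> 1 | G2 \<Rightarrow> 1 | A1 \<Rightarrow> 0 | A2 \<Rightarrow> 0)),
        antipode = induced_map (free_lift (opposite_algebra A) (\<lambda>x. case x of
            G1 \<Rightarrow> inv\<^bsub>A\<^esub> g1
          | G2 \<Rightarrow> inv\<^bsub>A\<^esub> g2
          | A1 \<Rightarrow> \<ominus>\<^bsub>A\<^esub> (inv\<^bsub>A\<^esub> g1 \<otimes>\<^bsub>A\<^esub> a1)
          | A2 \<Rightarrow> \<ominus>\<^bsub>A\<^esub> (inv\<^bsub>A\<^esub> g2 \<otimes>\<^bsub>A\<^esub> a2)))\<rparr>)"

end

theory Submission
  imports Defs
begin

text \<open>
  Since \<open>N\<close> is odd, \<open>\<omega> = g\<^sub>1\<^sup>N\<close> anticommutes with \<open>a\<^sub>1\<close> and \<open>a\<^sub>2\<close>, so that conjugation by \<open>\<omega>\<close> agrees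
  with the square of the antipode on generators; and \<open>\<omega>\<^sup>2 = 1\<close>, which makes the trace condition
  trivial.  The substance is that the structure maps respect the relations.  For the last relation put
  \<open>c = a\<^sub>1 a\<^sub>2 + a\<^sub>2 a\<^sub>1\<close>: the relation says
  \<open>c\<^sup>2 = \<lambda>\<^sub>3 (1 - g\<^sub>1\<^sup>2 g\<^sub>2\<^sup>2) - 4 \<lambda>\<^sub>1 \<lambda>\<^sub>2 g\<^sub>2\<^sup>2 (1 - g\<^sub>1\<^sup>2)\<close>, and \<open>\<Delta> c\<close> is the sum of the pairwise
  anticommuting elements \<open>c \<otimes> 1\<close>, \<open>2 g\<^sub>2 a\<^sub>1 \<otimes> a\<^sub>2\<close> and \<open>g\<^sub>1 g\<^sub>2 \<otimes> c\<close>.  The antipode maps \<open>c\<close> to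
  \<open>g\<^sub>1\<^sup>-\<^sup>1 g\<^sub>2\<^sup>-\<^sup>1 (a\<^sub>1 a\<^sub>2 - a\<^sub>2 a\<^sub>1)\<close>, whose square follows from that of \<open>a\<^sub>1 a\<^sub>2 - a\<^sub>2 a\<^sub>1\<close>.
  The coalgebra identities then hold because both sides are algebra maps which agree on generators; those
  for the antipode because they are inherited by products.
\<close>

section \<open>Algebras\<close>

text \<open>\<open>H_lambda\<close> is given only by a presentation, so no normal form of its
  elements is at hand. All computations are therefore made for a quadruple of elements of an
  arbitrary algebra satisfying the relations; they apply alike to the generators of H and to their
  intended images in H \<otimes> H and in the opposite algebra, and maps out of H come from the
  universal property. The element c is useful because it commutes with a1 and a2: each a_i^2 is a
  polynomial in g_i^2, hence commutes with the other a_j. Moreover c commutes with g1 and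
  anticommutes with g2; these signs make the summands of its coproduct anticommute. The square of
  the middle summand is 4 l1 l2 (R \<otimes> 1 - R \<otimes> g2^2) with R = g2^2 (1 - g1^2). Its
  first half cancels the unwanted term -4 l1 l2 R \<otimes> 1 of c^2 \<otimes> 1, and what is left
  assembles to the coproduct of R. The cross term of the last relation is exactly what makes this
  work.\<close>

lemma ground_simps [simp]:
  "carrier (ground :: 'k::field ring) = UNIV" "\<one>\<^bsub>(ground :: 'k ring)\<^esub> = 1"
  "\<zero>\<^bsub>(ground :: 'k ring)\<^esub> = 0" "x \<oplus>\<^bsub>(ground :: 'k ring)\<^esub> y = x + y"
  "x \<otimes>\<^bsub>(ground :: 'k ring)\<^esub> y = x * y"
  by (simp_all add: ring_of_type_algebra_def)

text \<open>The scalar axioms are phrased with the operations of the type \<open>'k\<close> instead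
  of those of the record \<open>ground\<close>, and negatives are only required to exist, so that
  each concrete algebra can be checked by simplification.\<close>

lemma assoc_algebraI:
  fixes A :: "('k::field, 'a, 'm) module_scheme" (structure)
  assumes "\<And>x y. \<lbrakk>x \<in> carrier A; y \<in> carrier A\<rbrakk> \<Longrightarrow> x \<oplus> y \<in> carrier A"
    and "\<zero> \<in> carrier A"
    and "\<And>x y z. \<lbrakk>x \<in> carrier A; y \<in> carrier A; z \<in> carrier A\<rbrakk> \<Longrightarrow> (x \<oplus> y) \<oplus> z = x \<oplus> (y \<oplus> z)"
    and "\<And>x y. \<lbrakk>x \<in> carrier A; y \<in> carrier A\<rbrakk> \<Longrightarrow> x \<oplus> y = y \<oplus> x"
    and "\<And>x. x \<in> carrier A \<Longrightarrow> \<zero> \<oplus> x = x"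
    and "\<And>x. x \<in> carrier A \<Longrightarrow> \<exists>y\<in>carrier A. y \<oplus> x = \<zero>"
    and "\<And>x y. \<lbrakk>x \<in> carrier A; y \<in> carrier A\<rbrakk> \<Longrightarrow> x \<otimes> y \<in> carrier A"
    and "\<one> \<in> carrier A"
    and "\<And>x y z. \<lbrakk>x \<in> carrier A; y \<in> carrier A; z \<in> carrier A\<rbrakk> \<Longrightarrow> (x \<otimes> y) \<otimes> z = x \<otimes> (y \<otimes> z)"
    and "\<And>x. x \<in> carrier A \<Longrightarrow> \<one> \<otimes> x = x"
    and "\<And>x. x \<in> carrier A \<Longrightarrow> x \<otimes> \<one> = x"
    and "\<And>x y z. \<lbrakk>x \<in> carrier A; y \<in> carrier A; z \<in> carrier A\<rbrakk> \<Longrightarrow> (x \<oplus> y) \<otimes> z = x \<otimes> z \<oplus> y \<otimes> z"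
    and "\<And>x y z. \<lbrakk>x \<in> carrier A; y \<in> carrier A; z \<in> carrier A\<rbrakk> \<Longrightarrow> z \<otimes> (x \<oplus> y) = z \<otimes> x \<oplus> z \<otimes> y"
    and "\<And>c x. x \<in> carrier A \<Longrightarrow> c \<odot> x \<in> carrier A"
    and "\<And>c d x. x \<in> carrier A \<Longrightarrow> (c + d) \<odot> x = c \<odot> x \<oplus> d \<odot> x"
    and "\<And>c x y. \<lbrakk>x \<in> carrier A; y \<in> carrier A\<rbrakk> \<Longrightarrow> c \<odot> (x \<oplus> y) = c \<odot> x \<oplus> c \<odot> y"
    and "\<And>c d x. x \<in> carrier A \<Longrightarrow> (c * d) \<odot> x = c \<odot> (d \<odot> x)"
    and "\<And>x. x \<in> carrier A \<Longrightarrow> 1 \<odot> x = x"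
    and "\<And>c x y. \<lbrakk>x \<in> carrier A; y \<in> carrier A\<rbrakk> \<Longrightarrow> (c \<odot> x) \<otimes> y = c \<odot> (x \<otimes> y)"
    and "\<And>c x y. \<lbrakk>x \<in> carrier A; y \<in> carrier A\<rbrakk> \<Longrightarrow> x \<otimes> (c \<odot> y) = c \<odot> (x \<otimes> y)"
  shows "assoc_algebra A"
proof -
  have G: "abelian_group A"
    by (rule abelian_groupI; rule assms; assumption)
  have M: "monoid A"
    by (rule monoidI; rule assms; assumption)
  have "ring A"
    by (rule ringI[OF G M]; rule assms; assumption)
  moreover have "Module.module (ground :: 'k ring) A"
    by (rule Module.moduleI[OF cring_from_type_algebra G]; unfold ground_simps; rule assms; assumption)
  ultimately show ?thesis
    by (intro assoc_algebra.intro assoc_algebra_axioms.intro assms)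
qed

context assoc_algebra
begin

lemma algebra_smult_closed [simp, intro]: "x \<in> carrier A \<Longrightarrow> c \<odot> x \<in> carrier A"
  using smult_closed[of c x] by simp

lemma algebra_smult_simps [simp]:
  "x \<in> carrier A \<Longrightarrow> 1 \<odot> x = x" "x \<in> carrier A \<Longrightarrow> 0 \<odot> x = \<zero>" "c \<odot> \<zero> = \<zero>"
  using smult_one[of x] smult_l_null[of x] smult_r_null[of c] by simp_all

lemma l_neg_exists: "x \<in> carrier A \<Longrightarrow> \<exists>y\<in>carrier A. y \<oplus> x = \<zero>"
  by (rule bexI[of _ "\<ominus> x"]) (simp_all add: l_neg)

lemma add_smult: "x \<in> carrier A \<Longrightarrow> (c + d) \<odot> x = c \<odot> x \<oplus> d \<odot> x"
  using smult_l_distr[of c d x] by simp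

lemma smult_add: "\<lbrakk>x \<in> carrier A; y \<in> carrier A\<rbrakk> \<Longrightarrow> c \<odot> (x \<oplus> y) = c \<odot> x \<oplus> c \<odot> y"
  using smult_r_distr[of c x y] by simp

lemma smult_smult: "x \<in> carrier A \<Longrightarrow> c \<odot> (d \<odot> x) = (c * d) \<odot> x"
  using smult_assoc1[of c d x] by simp

lemma uminus_smult: "x \<in> carrier A \<Longrightarrow> (- c) \<odot> x = \<ominus> (c \<odot> x)"
  using add_smult[of x "- c" c] by (simp add: minus_equality)

lemma smult_uminus: "x \<in> carrier A \<Longrightarrow> c \<odot> (\<ominus> x) = \<ominus> (c \<odot> x)"
  using smult_add[of "\<ominus> x" x c] by (simp add: minus_equality l_neg)

lemma smult_minus: "\<lbrakk>x \<in> carrier A; y \<in> carrier A\<rbrakk> \<Longrightarrow> c \<odot> (x \<ominus> y) = c \<odot> x \<ominus> c \<odot> y"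
  by (simp add: a_minus_def smult_add smult_uminus)

text \<open>Since c x = (c 1) x, a two-sided ideal of the ring is automatically a subspace. This is
  why ring ideals suffice to form quotient algebras.\<close>

lemma ideal_smult_closed: "\<lbrakk>ideal I A; x \<in> I\<rbrakk> \<Longrightarrow> c \<odot> x \<in> I"
  using ideal.I_l_closed[of I A x "c \<odot> \<one>"] ideal.Icarr[of I A x]
  by (simp add: smult_mult_left)

end

text \<open>Carries the algebra structure over to a record of another type with the same operations,
  namely from \<open>H_alg\<close> to \<open>H_lambda\<close>, which has additional Hopf
  fields.\<close>

lemma assoc_algebra_cong:
  fixes A :: "('k::field, 'a, 'm) module_scheme" and B :: "('k, 'a, 'n) module_scheme"
  assumes "assoc_algebra A"
    and [simp]: "carrier B = carrier A" "monoid.mult B = monoid.mult A" "\<one>\<^bsub>B\<^esub> = \<one>\<^bsub>A\<^esub>"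
      "\<zero>\<^bsub>B\<^esub> = \<zero>\<^bsub>A\<^esub>" "add B = add A" "module.smult B = module.smult A"
  shows "assoc_algebra B"
proof -
  interpret assoc_algebra A by fact
  show ?thesis
    by (rule assoc_algebraI)
      (auto simp: a_ac m_assoc l_distr r_distr add_smult smult_add smult_smult
        smult_mult_left smult_mult_right l_neg_exists)
qed

lemma base_algebra_assoc_algebra: "assoc_algebra (base_algebra :: ('k::field, 'k) module)"
proof -
  have "\<exists>y. y + x = 0" for x :: 'k
    by (rule exI[of _ "- x"]) simp
  then show ?thesis
    by (intro assoc_algebraI) (auto simp: base_algebra_def algebra_simps)
qed

lemma opposite_algebra_assoc_algebra:
  assumes "assoc_algebra A"
  shows "assoc_algebra (opposite_algebra A)"
proof -
  interpret assoc_algebra A by fact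
  show ?thesis
    by (rule assoc_algebraI)
      (auto simp: opposite_algebra_def a_ac m_assoc l_distr r_distr add_smult smult_add
        smult_smult smult_mult_left smult_mult_right l_neg_exists)
qed

lemma linear_mapsI:
  assumes "\<And>x. x \<in> carrier V \<Longrightarrow> f x \<in> carrier W"
    and "\<And>x y. \<lbrakk>x \<in> carrier V; y \<in> carrier V\<rbrakk> \<Longrightarrow> f (x \<oplus>\<^bsub>V\<^esub> y) = f x \<oplus>\<^bsub>W\<^esub> f y"
    and "\<And>c x. x \<in> carrier V \<Longrightarrow> f (c \<odot>\<^bsub>V\<^esub> x) = c \<odot>\<^bsub>W\<^esub> f x"
  shows "f \<in> linear_maps V W"
  using assms by (auto simp: linear_maps_def)

lemma linear_mapsD:
  assumes "f \<in> linear_maps V W" "x \<in> carrier V"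
  shows "f x \<in> carrier W" "f (c \<odot>\<^bsub>V\<^esub> x) = c \<odot>\<^bsub>W\<^esub> f x"
    "y \<in> carrier V \<Longrightarrow> f (x \<oplus>\<^bsub>V\<^esub> y) = f x \<oplus>\<^bsub>W\<^esub> f y"
  using assms by (auto simp: linear_maps_def)

lemma linear_maps_comp:
  "\<lbrakk>f \<in> linear_maps U V; g \<in> linear_maps V W\<rbrakk> \<Longrightarrow> (\<lambda>x. g (f x)) \<in> linear_maps U W"
  by (auto simp: linear_maps_def Pi_def)

lemma algebra_homsI:
  assumes "f \<in> linear_maps A B"
    and "\<And>x y. \<lbrakk>x \<in> carrier A; y \<in> carrier A\<rbrakk> \<Longrightarrow> f (x \<otimes>\<^bsub>A\<^esub> y) = f x \<otimes>\<^bsub>B\<^esub> f y"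
    and "f \<one>\<^bsub>A\<^esub> = \<one>\<^bsub>B\<^esub>"
  shows "f \<in> algebra_homs A B"
  using assms by (auto simp: algebra_homs_def linear_maps_def ring_hom_def)

lemma algebra_homsD:
  assumes "f \<in> algebra_homs A B"
  shows "f \<in> linear_maps A B" "f \<one>\<^bsub>A\<^esub> = \<one>\<^bsub>B\<^esub>"
    "\<lbrakk>x \<in> carrier A; y \<in> carrier A\<rbrakk> \<Longrightarrow> f (x \<otimes>\<^bsub>A\<^esub> y) = f x \<otimes>\<^bsub>B\<^esub> f y"
  using assms by (auto simp: algebra_homs_def ring_hom_def)

lemma algebra_homs_comp:
  assumes "f \<in> algebra_homs A B" "g \<in> algebra_homs B C"
  shows "(\<lambda>x. g (f x)) \<in> algebra_homs A C"
  using assms by (auto simp: algebra_homs_def ring_hom_def Pi_def intro: linear_maps_comp)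

lemma linear_maps_id: "(\<lambda>x. x) \<in> linear_maps A A"
  by (auto intro!: linear_mapsI)

lemma algebra_homs_id: "(\<lambda>x. x) \<in> algebra_homs A A"
  by (auto intro!: algebra_homsI linear_maps_id)

locale linear_map = A?: assoc_algebra A + B: assoc_algebra B
  for A :: "('k::field, 'a, 'm) module_scheme" (structure)
    and B :: "('k, 'b, 'n) module_scheme" +
  fixes f
  assumes linear: "f \<in> linear_maps A B"
begin

lemmas map_closed [simp, intro] = linear_mapsD(1)[OF linear]
lemmas map_smult = linear_mapsD(2)[OF linear]
lemmas map_add = linear_mapsD(3)[OF linear]

lemma map_zero [simp]: "f \<zero> = \<zero>\<^bsub>B\<^esub>"
  using map_smult[of \<zero> 0] by simp

lemma map_uminus: "x \<in> carrier A \<Longrightarrow> f (\<ominus> x) = \<ominus>\<^bsub>B\<^esub> f x"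
  using map_smult[of x "- 1"] by (simp add: uminus_smult B.uminus_smult)

lemma map_minus: "\<lbrakk>x \<in> carrier A; y \<in> carrier A\<rbrakk> \<Longrightarrow> f (x \<ominus> y) = f x \<ominus>\<^bsub>B\<^esub> f y"
  by (simp add: a_minus_def map_add map_uminus)

end


section \<open>Quotient algebras\<close>

context assoc_algebra
begin

context
  fixes I
  assumes ideal: "ideal I A"
begin

interpretation ideal I A by (rule ideal)

lemma quotient_carrier: "carrier (quotient_algebra A I) = (\<lambda>x. I +> x) ` carrier A"
  by (simp add: quotient_algebra_def FactRing_simps Setcompr_eq_image image_def) blast

lemma coset_eq_iff: "\<lbrakk>x \<in> carrier A; y \<in> carrier A\<rbrakk> \<Longrightarrow> I +> x = I +> y \<longleftrightarrow> x \<ominus> y \<in> I"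
  using quotient_eq_iff_same_a_r_cos[OF ideal] by blast

text \<open>Scalar multiplication on cosets is defined as a union over all representatives; the
  cosets in that union all coincide because the ideal is closed under scalars.\<close>

lemma quotient_smult:
  assumes "x \<in> carrier A"
  shows "c \<odot>\<^bsub>quotient_algebra A I\<^esub> (I +> x) = I +> (c \<odot> x)"
proof -
  have "I +> (c \<odot> y) = I +> (c \<odot> x)" if "y \<in> I +> x" for y
  proof -
    have y: "y \<in> carrier A"
      using that assms a_elemrcos_carrier by blast
    have "y \<ominus> x \<in> I"
      using that assms y a_rcos_module_minus[OF ring_axioms] by blast
    then show ?thesis
      using assms y ideal_smult_closed[OF ideal, of "y \<ominus> x" c]
      by (simp add: coset_eq_iff smult_minus)
  qed
  moreover have "I +> x \<noteq> {}"
    using assms a_rcos_self by blast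
  ultimately show ?thesis
    by (simp add: quotient_algebra_def UN_constant_eq)
qed

lemma quotient_ops:
  "\<lbrakk>x \<in> carrier A; y \<in> carrier A\<rbrakk> \<Longrightarrow>
     (I +> x) \<oplus>\<^bsub>quotient_algebra A I\<^esub> (I +> y) = I +> (x \<oplus> y)"
  "\<lbrakk>x \<in> carrier A; y \<in> carrier A\<rbrakk> \<Longrightarrow>
     (I +> x) \<otimes>\<^bsub>quotient_algebra A I\<^esub> (I +> y) = I +> (x \<otimes> y)"
  "\<zero>\<^bsub>quotient_algebra A I\<^esub> = I +> \<zero>"
  "\<one>\<^bsub>quotient_algebra A I\<^esub> = I +> \<one>"
  using a_rcos_zero[OF ideal zero_closed]
  by (simp_all add: quotient_algebra_def FactRing_def rcoset_mult_add a_rcos_sum)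

lemma quotient_assoc_algebra: "assoc_algebra (quotient_algebra A I)"
proof -
  have "\<exists>y\<in>(\<lambda>x. I +> x) ` carrier A. y \<oplus>\<^bsub>quotient_algebra A I\<^esub> (I +> x) = I +> \<zero>"
    if "x \<in> carrier A" for x
    using that by (intro bexI[of _ "I +> (\<ominus> x)"]) (simp_all add: quotient_ops l_neg)
  then show ?thesis
    by (intro assoc_algebraI; (unfold quotient_carrier)?; (elim imageE)?)
      (simp_all add: quotient_ops quotient_smult a_ac m_assoc l_distr r_distr
        add_smult smult_add smult_smult smult_mult_left smult_mult_right)
qed

lemma coset_algebra_hom: "(\<lambda>x. I +> x) \<in> algebra_homs A (quotient_algebra A I)"
  by (intro algebra_homsI linear_mapsI) (auto simp: quotient_carrier quotient_ops quotient_smult)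

text \<open>A linear map vanishing on the ideal is constant on each coset, so its image there is a
  singleton and \<open>the_elem\<close> returns the common value.\<close>

lemma induced_map_coset:
  assumes "assoc_algebra B" and f: "f \<in> linear_maps A B" "\<And>x. x \<in> I \<Longrightarrow> f x = \<zero>\<^bsub>B\<^esub>"
    and x: "x \<in> carrier A"
  shows "induced_map f (I +> x) = f x"
proof -
  interpret linear_map A B f
    using assms(1) f(1) by (intro linear_map.intro assoc_algebra_axioms linear_map_axioms.intro)
  have "f y = f x" if "y \<in> I +> x" for y
  proof -
    have y: "y \<in> carrier A"
      using that x a_elemrcos_carrier by blast
    have "y \<ominus> x \<in> I"
      using that x y a_rcos_module_minus[OF ring_axioms] by blast
    then show ?thesis
      using x y f(2)[of "y \<ominus> x"] by (simp add: map_minus B.r_right_minus_eq)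
  qed
  moreover have "x \<in> I +> x"
    using x a_rcos_self by blast
  ultimately have "f ` (I +> x) = {f x}"
    by blast
  then show ?thesis
    by (simp add: induced_map_def)
qed

lemma induced_map_linear:
  assumes "assoc_algebra B" "f \<in> linear_maps A B" "\<And>x. x \<in> I \<Longrightarrow> f x = \<zero>\<^bsub>B\<^esub>"
  shows "induced_map f \<in> linear_maps (quotient_algebra A I) B"
  by (rule linear_mapsI)
    (auto simp: quotient_carrier quotient_ops quotient_smult induced_map_coset[OF assms]
      linear_mapsD[OF assms(2)])

lemma induced_map_algebra_hom:
  assumes "assoc_algebra B" and f: "f \<in> algebra_homs A B" "\<And>x. x \<in> I \<Longrightarrow> f x = \<zero>\<^bsub>B\<^esub>"
  shows "induced_map f \<in> algebra_homs (quotient_algebra A I) B"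
  by (intro algebra_homsI induced_map_linear assms)
    (auto simp: quotient_carrier quotient_ops algebra_homsD[OF f(1)]
      induced_map_coset[OF assms(1) algebra_homsD(1)[OF f(1)] f(2)])

end

end

section \<open>Monoid algebras\<close>

lemma lookup_scale:
  "Poly_Mapping.lookup (Poly_Mapping.map ((*) c) p) x = (c :: 'k::field) * Poly_Mapping.lookup p x"
  by (simp add: Poly_Mapping.map.rep_eq when_def)

lemma scale_single [simp]:
  "Poly_Mapping.map ((*) c) (Poly_Mapping.single x d) = Poly_Mapping.single x (c * d :: 'k::field)"
  by simp

lemma keys_scale: "Poly_Mapping.keys (Poly_Mapping.map ((*) (c :: 'k::field)) p) \<subseteq> Poly_Mapping.keys p"
  by (auto simp: in_keys_iff lookup_scale)

text \<open>Makes available the theory of \<open>span\<close> and \<open>subspace\<close> in which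
  \<open>bilinearity_subspace\<close> is defined.\<close>

interpretation scale: Modules.module "\<lambda>c :: 'k::field. Poly_Mapping.map ((*) c)"
  by unfold_locales
    (auto intro!: poly_mapping_eqI simp: lookup_scale lookup_add algebra_simps)

lemma keys_subset_induct [consumes 1, case_names zero single_add]:
  assumes "Poly_Mapping.keys p \<subseteq> U" and "P 0"
    and step: "\<And>x c q. \<lbrakk>x \<in> U; Poly_Mapping.keys q \<subseteq> U; P q\<rbrakk> \<Longrightarrow> P (Poly_Mapping.single x c + q)"
  shows "P p"
  using assms(1)
proof (induction p rule: update_induct)
  case const
  show ?case by (rule assms(2))
next
  case (update q x c)
  \<comment> \<open>The point x lies outside the support of q, so updating there amounts to adding a
    monomial.\<close>
  have "Poly_Mapping.update x c q = Poly_Mapping.single x c + q"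
    using update(1) by (intro poly_mapping_eqI) (auto simp: lookup_update lookup_add lookup_single in_keys_iff when_def)
  moreover have "x \<in> U" "Poly_Mapping.keys q \<subseteq> U"
    using update by (auto simp: keys_update)
  ultimately show ?case
    using update by (auto intro: step)
qed

lemma monoid_algebra_simps:
  "carrier (monoid_algebra G) = {p. Poly_Mapping.keys p \<subseteq> carrier G}"
  "\<one>\<^bsub>monoid_algebra G\<^esub> = Poly_Mapping.single \<one>\<^bsub>G\<^esub> 1"
  "\<zero>\<^bsub>monoid_algebra G\<^esub> = 0"
  "p \<oplus>\<^bsub>monoid_algebra G\<^esub> q = p + q"
  "c \<odot>\<^bsub>monoid_algebra G\<^esub> p = Poly_Mapping.map ((*) c) p"
  by (simp_all add: monoid_algebra_def)

text \<open>Coefficients outside the support vanish, so the sums may run over larger finite sets.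
  This gives p, q and p + q a common index set, although their supports differ.\<close>

lemma monoid_algebra_mult_superset:
  assumes "finite S" "Poly_Mapping.keys p \<subseteq> S" "finite T" "Poly_Mapping.keys q \<subseteq> T"
  shows "p \<otimes>\<^bsub>monoid_algebra G\<^esub> q = (\<Sum>x\<in>S. \<Sum>y\<in>T. Poly_Mapping.single (x \<otimes>\<^bsub>G\<^esub> y)
    (Poly_Mapping.lookup p x * Poly_Mapping.lookup q y :: 'k::field))"
proof -
  have "p \<otimes>\<^bsub>monoid_algebra G\<^esub> q = (\<Sum>x\<in>Poly_Mapping.keys p. \<Sum>y\<in>T. Poly_Mapping.single (x \<otimes>\<^bsub>G\<^esub> y)
    (Poly_Mapping.lookup p x * Poly_Mapping.lookup q y))"
    unfolding monoid_algebra_def monoid.simps partial_object.simps using assms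
    by (intro sum.cong refl sum.mono_neutral_left) (auto simp: in_keys_iff)
  also have "\<dots> = (\<Sum>x\<in>S. \<Sum>y\<in>T. Poly_Mapping.single (x \<otimes>\<^bsub>G\<^esub> y)
    (Poly_Mapping.lookup p x * Poly_Mapping.lookup q y))"
    using assms by (intro sum.mono_neutral_left) (auto simp: in_keys_iff)
  finally show ?thesis .
qed

lemma monoid_algebra_mult_single:
  "Poly_Mapping.single x c \<otimes>\<^bsub>monoid_algebra G\<^esub> Poly_Mapping.single y d =
    Poly_Mapping.single (x \<otimes>\<^bsub>G\<^esub> y) (c * d :: 'k::field)"
  by (subst monoid_algebra_mult_superset[of "{x}" _ "{y}"]) auto

lemma monoid_algebra_mult_zero [simp]:
  "0 \<otimes>\<^bsub>monoid_algebra G\<^esub> q = (0 :: _ \<Rightarrow>\<^sub>0 'k::field)" "p \<otimes>\<^bsub>monoid_algebra G\<^esub> 0 = (0 :: _ \<Rightarrow>\<^sub>0 'k::field)"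
  by (simp_all add: monoid_algebra_def)

lemma monoid_algebra_l_distr:
  fixes p q r :: "'g \<Rightarrow>\<^sub>0 'k::field"
  shows "(p + q) \<otimes>\<^bsub>monoid_algebra G\<^esub> r = p \<otimes>\<^bsub>monoid_algebra G\<^esub> r + q \<otimes>\<^bsub>monoid_algebra G\<^esub> r"
proof -
  define S where "S = Poly_Mapping.keys p \<union> Poly_Mapping.keys q"
  have S: "finite S" "Poly_Mapping.keys p \<subseteq> S" "Poly_Mapping.keys q \<subseteq> S" "Poly_Mapping.keys (p + q) \<subseteq> S"
    using keys_add[of p q] by (auto simp: S_def)
  show ?thesis
    by (simp only: monoid_algebra_mult_superset[OF S(1) _ finite_keys subset_refl] S lookup_add
        distrib_right single_add sum.distrib)
qed

lemma monoid_algebra_r_distr: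
  fixes p q r :: "'g \<Rightarrow>\<^sub>0 'k::field"
  shows "r \<otimes>\<^bsub>monoid_algebra G\<^esub> (p + q) = r \<otimes>\<^bsub>monoid_algebra G\<^esub> p + r \<otimes>\<^bsub>monoid_algebra G\<^esub> q"
proof -
  define S where "S = Poly_Mapping.keys p \<union> Poly_Mapping.keys q"
  have S: "finite S" "Poly_Mapping.keys p \<subseteq> S" "Poly_Mapping.keys q \<subseteq> S" "Poly_Mapping.keys (p + q) \<subseteq> S"
    using keys_add[of p q] by (auto simp: S_def)
  show ?thesis
    by (simp only: monoid_algebra_mult_superset[OF finite_keys subset_refl S(1)] S lookup_add
        distrib_left single_add sum.distrib)
qed

lemma monoid_algebra_smult_left:
  fixes p q :: "'g \<Rightarrow>\<^sub>0 'k::field"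
  shows "Poly_Mapping.map ((*) c) p \<otimes>\<^bsub>monoid_algebra G\<^esub> q = Poly_Mapping.map ((*) c) (p \<otimes>\<^bsub>monoid_algebra G\<^esub> q)"
  unfolding monoid_algebra_mult_superset[OF finite_keys keys_scale finite_keys subset_refl]
  by (simp only: monoid_algebra_mult_superset[OF finite_keys subset_refl finite_keys subset_refl]
      lookup_scale scale.scale_sum_right scale_single mult.assoc)

lemma monoid_algebra_smult_right:
  fixes p q :: "'g \<Rightarrow>\<^sub>0 'k::field"
  shows "p \<otimes>\<^bsub>monoid_algebra G\<^esub> Poly_Mapping.map ((*) c) q = Poly_Mapping.map ((*) c) (p \<otimes>\<^bsub>monoid_algebra G\<^esub> q)"
  unfolding monoid_algebra_mult_superset[OF finite_keys subset_refl finite_keys keys_scale]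
  by (simp only: monoid_algebra_mult_superset[OF finite_keys subset_refl finite_keys subset_refl]
      lookup_scale scale.scale_sum_right scale_single mult.left_commute)

lemma monoid_algebra_assoc_algebra:
  assumes "monoid G"
  shows "assoc_algebra (monoid_algebra G :: ('k::field, _) module)"
proof -
  interpret monoid G by fact
  let ?A = "monoid_algebra G :: ('k, _) module"
  have closed: "Poly_Mapping.keys (p \<otimes>\<^bsub>?A\<^esub> q) \<subseteq> carrier G"
    if "Poly_Mapping.keys p \<subseteq> carrier G" "Poly_Mapping.keys q \<subseteq> carrier G" for p q
  proof -
    have "p \<otimes>\<^bsub>?A\<^esub> q = (\<Sum>x\<in>Poly_Mapping.keys p. \<Sum>y\<in>Poly_Mapping.keys q.
       Poly_Mapping.single (x \<otimes>\<^bsub>G\<^esub> y) (Poly_Mapping.lookup p x * Poly_Mapping.lookup q y))"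
      by (simp add: monoid_algebra_def)
    also have "Poly_Mapping.keys \<dots> \<subseteq> (\<Union>x\<in>Poly_Mapping.keys p. \<Union>y\<in>Poly_Mapping.keys q. {x \<otimes>\<^bsub>G\<^esub> y})"
      by (intro order.trans[OF keys_sum] UN_mono subset_refl) auto
    also have "\<dots> \<subseteq> carrier G"
      using that by auto
    finally show ?thesis .
  qed
  \<comment> \<open>Associativity is linear in each factor and is reduced to monomials one factor at
    a time: the right one here, the middle one in \<open>assoc2\<close>, the left one in
    \<open>assoc\<close>.\<close>
  have assoc1: "(Poly_Mapping.single x c \<otimes>\<^bsub>?A\<^esub> Poly_Mapping.single y d) \<otimes>\<^bsub>?A\<^esub> r =
      Poly_Mapping.single x c \<otimes>\<^bsub>?A\<^esub> (Poly_Mapping.single y d \<otimes>\<^bsub>?A\<^esub> r)"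
    if "x \<in> carrier G" "y \<in> carrier G" "Poly_Mapping.keys r \<subseteq> carrier G" for x y c d r
    using that(3)
    by (induction r rule: keys_subset_induct)
      (auto simp: monoid_algebra_r_distr monoid_algebra_mult_single m_assoc that mult.assoc)
  have assoc2: "(Poly_Mapping.single x c \<otimes>\<^bsub>?A\<^esub> q) \<otimes>\<^bsub>?A\<^esub> r =
      Poly_Mapping.single x c \<otimes>\<^bsub>?A\<^esub> (q \<otimes>\<^bsub>?A\<^esub> r)"
    if "x \<in> carrier G" "Poly_Mapping.keys q \<subseteq> carrier G" "Poly_Mapping.keys r \<subseteq> carrier G" for x c q r
    using that(2)
    by (induction q rule: keys_subset_induct)
      (auto simp: monoid_algebra_r_distr monoid_algebra_l_distr assoc1 that)
  have assoc: "(p \<otimes>\<^bsub>?A\<^esub> q) \<otimes>\<^bsub>?A\<^esub> r = p \<otimes>\<^bsub>?A\<^esub> (q \<otimes>\<^bsub>?A\<^esub> r)"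
    if "Poly_Mapping.keys p \<subseteq> carrier G" "Poly_Mapping.keys q \<subseteq> carrier G" "Poly_Mapping.keys r \<subseteq> carrier G" for p q r
    using that(1)
    by (induction p rule: keys_subset_induct)
      (auto simp: monoid_algebra_l_distr assoc2 that)
  have one: "\<one>\<^bsub>?A\<^esub> \<otimes>\<^bsub>?A\<^esub> p = p" "p \<otimes>\<^bsub>?A\<^esub> \<one>\<^bsub>?A\<^esub> = p" if "Poly_Mapping.keys p \<subseteq> carrier G" for p
    using that
    by (induction p rule: keys_subset_induct)
      (auto simp: monoid_algebra_l_distr monoid_algebra_r_distr monoid_algebra_mult_single monoid_algebra_simps)
  have neg: "\<exists>q. Poly_Mapping.keys q \<subseteq> carrier G \<and> p + q = 0"
    if "Poly_Mapping.keys p \<subseteq> carrier G" for p :: "_ \<Rightarrow>\<^sub>0 'k"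
    using that by (intro exI[of _ "- p"]) simp_all
  have add_closed: "Poly_Mapping.keys (p + q) \<subseteq> carrier G"
    if "Poly_Mapping.keys p \<subseteq> carrier G" "Poly_Mapping.keys q \<subseteq> carrier G" for p q :: "_ \<Rightarrow>\<^sub>0 'k"
    using that keys_add[of p q] by blast
  have smult_closed: "Poly_Mapping.keys (Poly_Mapping.map ((*) c) p) \<subseteq> carrier G"
    if "Poly_Mapping.keys p \<subseteq> carrier G" for p :: "_ \<Rightarrow>\<^sub>0 'k" and c
    using that keys_scale[of c p] by blast
  show ?thesis
    by (rule assoc_algebraI; unfold monoid_algebra_simps mem_Collect_eq)
      (simp_all add: closed add_closed smult_closed assoc one[unfolded monoid_algebra_simps] neg
        monoid_algebra_l_distr monoid_algebra_r_distr monoid_algebra_smult_left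
        monoid_algebra_smult_right scale.scale_left_distrib scale.scale_right_distrib add_ac)
qed

section \<open>Linear extension from the basis of monoid elements\<close>

lemma (in assoc_algebra) linear_extension_superset:
  assumes "f \<in> U \<rightarrow> carrier A" "Poly_Mapping.keys p \<subseteq> S" "finite S" "S \<subseteq> U"
  shows "linear_extension A f p = (\<Oplus>x\<in>S. Poly_Mapping.lookup p x \<odot> f x)"
proof -
  have f: "f x \<in> carrier A" if "x \<in> S" for x
    using that assms by blast
  show ?thesis
    unfolding linear_extension_def
    by (rule add.finprod_mono_neutral_cong_left) (use assms f in \<open>auto simp: in_keys_iff\<close>)
qed

lemma (in assoc_algebra) linear_extension_single:
  assumes "f x \<in> carrier A"
  shows "linear_extension A f (Poly_Mapping.single x c) = c \<odot> f x"
  using linear_extension_superset[of f "{x}" "Poly_Mapping.single x c" "{x}"] assms by simp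

lemma (in assoc_algebra) linear_extension_linear:
  assumes f: "f \<in> carrier G \<rightarrow> carrier A"
  shows "linear_extension A f \<in> linear_maps (monoid_algebra G) A"
proof (rule linear_mapsI)
  fix p :: "_ \<Rightarrow>\<^sub>0 'k" assume p: "p \<in> carrier (monoid_algebra G)"
  then have p': "Poly_Mapping.keys p \<subseteq> carrier G" by (simp add: monoid_algebra_simps)
  have fx: "f x \<in> carrier A" if "x \<in> Poly_Mapping.keys p" for x
    using that f p' by blast
  show "linear_extension A f p \<in> carrier A"
    unfolding linear_extension_def by (rule finsum_closed) (use fx in auto)
  show "linear_extension A f (c \<odot>\<^bsub>monoid_algebra G\<^esub> p) = c \<odot> linear_extension A f p" for c
  proof -
    have "c \<odot> (\<Oplus>x\<in>S. Poly_Mapping.lookup p x \<odot> f x) = (\<Oplus>x\<in>S. (c * Poly_Mapping.lookup p x) \<odot> f x)"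
      if "finite S" "S \<subseteq> Poly_Mapping.keys p" for S
      using that by (induction S rule: finite_induct) (use fx in \<open>auto simp: smult_add smult_smult finsum_insert Pi_def subset_iff\<close>)
    from this[of "Poly_Mapping.keys p"] show ?thesis
      by (simp add: linear_extension_superset[OF f keys_scale finite_keys p'] lookup_scale
          monoid_algebra_simps linear_extension_superset[OF f subset_refl finite_keys p'])
  qed
  fix q :: "_ \<Rightarrow>\<^sub>0 'k" assume q: "q \<in> carrier (monoid_algebra G)"
  define S where "S = Poly_Mapping.keys p \<union> Poly_Mapping.keys q"
  have S: "finite S" "Poly_Mapping.keys p \<subseteq> S" "Poly_Mapping.keys q \<subseteq> S" "Poly_Mapping.keys (p + q) \<subseteq> S"
    "S \<subseteq> carrier G"
    using keys_add[of p q] p q by (auto simp: S_def monoid_algebra_simps)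
  have fS: "f x \<in> carrier A" if "x \<in> S" for x
    using that f S by blast
  have "(\<Oplus>x\<in>S. Poly_Mapping.lookup (p + q) x \<odot> f x) =
      (\<Oplus>x\<in>S. Poly_Mapping.lookup p x \<odot> f x \<oplus> Poly_Mapping.lookup q x \<odot> f x)"
    by (rule finsum_cong') (use fS in \<open>auto simp: lookup_add add_smult\<close>)
  also have "\<dots> = (\<Oplus>x\<in>S. Poly_Mapping.lookup p x \<odot> f x) \<oplus> (\<Oplus>x\<in>S. Poly_Mapping.lookup q x \<odot> f x)"
    by (rule finsum_addf) (use fS in auto)
  finally show "linear_extension A f (p \<oplus>\<^bsub>monoid_algebra G\<^esub> q) =
      linear_extension A f p \<oplus> linear_extension A f q"
    using S by (simp add: linear_extension_superset[OF f _ S(1) S(5)] monoid_algebra_simps)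
qed

lemma monoid_algebra_induct [consumes 1, case_names zero smult add]:
  assumes "p \<in> carrier (monoid_algebra G :: ('k::field, 'g \<Rightarrow>\<^sub>0 'k) module)"
    and "P 0"
    and "\<And>x c. x \<in> carrier G \<Longrightarrow> P (Poly_Mapping.single x c)"
    and "\<And>p q. \<lbrakk>p \<in> carrier (monoid_algebra G :: ('k, 'g \<Rightarrow>\<^sub>0 'k) module);
      q \<in> carrier (monoid_algebra G :: ('k, 'g \<Rightarrow>\<^sub>0 'k) module); P p; P q\<rbrakk> \<Longrightarrow> P (p + q)"
  shows "P p"
proof -
  from assms(1) have "Poly_Mapping.keys p \<subseteq> carrier G"
    by (simp add: monoid_algebra_simps)
  then show ?thesis
    by (induction p rule: keys_subset_induct) (auto intro!: assms(2-) simp: monoid_algebra_simps)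
qed

text \<open>Both sides of the product formula are bilinear, so the formula on monomials, which is
  multiplicativity of f, suffices. In \<open>1\<close> the left factor is a monomial, in
  \<open>2\<close> both factors are general.\<close>

lemma linear_extension_algebra_hom:
  assumes "monoid G" "assoc_algebra A" and f: "f \<in> carrier G \<rightarrow> carrier A" "f \<one>\<^bsub>G\<^esub> = \<one>\<^bsub>A\<^esub>"
    and f_mult: "\<And>x y. \<lbrakk>x \<in> carrier G; y \<in> carrier G\<rbrakk> \<Longrightarrow> f (x \<otimes>\<^bsub>G\<^esub> y) = f x \<otimes>\<^bsub>A\<^esub> f y"
  shows "linear_extension A f \<in> algebra_homs (monoid_algebra G) (A :: ('k::field, 'a, 'm) module_scheme)"
proof -
  let ?M = "monoid_algebra G :: ('k, _) module" and ?f = "linear_extension A f"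
  interpret monoid G by fact
  interpret A: assoc_algebra A by fact
  interpret M: assoc_algebra ?M using monoid_algebra_assoc_algebra[OF assms(1)] .
  interpret linear_map ?M A ?f
    by unfold_locales (rule A.linear_extension_linear[OF f(1)])
  have sing: "?f (Poly_Mapping.single x c) = c \<odot>\<^bsub>A\<^esub> f x" if "x \<in> carrier G" for x c
    using f(1) that by (intro A.linear_extension_single) auto
  have fcl: "f x \<in> carrier A" if "x \<in> carrier G" for x
    using f(1) that by auto
  have ext_add: "?f (p + q) = ?f p \<oplus>\<^bsub>A\<^esub> ?f q" if "p \<in> carrier ?M" "q \<in> carrier ?M" for p q
    using map_add[OF that] by (simp add: monoid_algebra_simps)
  have sc: "Poly_Mapping.single x c \<in> carrier ?M" if "x \<in> carrier G" for x c
    using that by (simp add: monoid_algebra_simps)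
  have ext_zero: "?f 0 = \<zero>\<^bsub>A\<^esub>"
    using map_zero by (simp add: monoid_algebra_simps)
  have 1: "?f (Poly_Mapping.single x c \<otimes>\<^bsub>?M\<^esub> q) = c \<odot>\<^bsub>A\<^esub> f x \<otimes>\<^bsub>A\<^esub> ?f q"
    if "x \<in> carrier G" "q \<in> carrier ?M" for x c q
    using that(2)
  proof (induction q rule: monoid_algebra_induct)
    case zero
    then show ?case using that(1) fcl by (simp add: ext_zero)
  next
    case (smult y d)
    then show ?case
      using that(1) fcl
      by (simp add: monoid_algebra_mult_single sing f_mult A.smult_mult_left A.smult_mult_right
          A.smult_smult mult.commute)
  next
    case (add p q)
    then show ?case
      using that(1) fcl M.m_closed[OF sc[OF that(1)]]
      by (simp add: monoid_algebra_r_distr ext_add A.r_distr)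
  qed
  have 2: "?f (p \<otimes>\<^bsub>?M\<^esub> q) = ?f p \<otimes>\<^bsub>A\<^esub> ?f q" if "p \<in> carrier ?M" "q \<in> carrier ?M" for p q
    using that(1)
  proof (induction p rule: monoid_algebra_induct)
    case zero
    then show ?case using that(2) by (simp add: ext_zero)
  next
    case (smult x c)
    then show ?case using that(2) by (simp add: 1 sing)
  next
    case (add p p')
    then show ?case
      using that(2)
      by (simp add: monoid_algebra_l_distr ext_add A.l_distr)
  qed
  show ?thesis
    by (intro algebra_homsI linear) (simp_all add: 2 monoid_algebra_simps sing f(2))
qed

section \<open>Free algebras\<close>

abbreviation free_monoid :: "'x list monoid"
  where "free_monoid \<equiv> \<lparr>carrier = UNIV, monoid.mult = (@), one = []\<rparr>"

lemma free_monoid: "monoid free_monoid"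
  by (rule monoidI) auto

lemma free_algebra_assoc_algebra: "assoc_algebra (free_algebra :: ('k::field, 'x list \<Rightarrow>\<^sub>0 'k) module)"
  unfolding free_algebra_def by (rule monoid_algebra_assoc_algebra[OF free_monoid])

lemma free_gen_closed [simp]: "free_gen x \<in> carrier free_algebra"
  by (simp add: free_algebra_def monoid_algebra_simps)

context
  fixes B :: "('k::field, 'b, 'm) module_scheme" (structure) and f :: "'x \<Rightarrow> 'b"
  assumes B: "assoc_algebra B" and f: "\<And>x. f x \<in> carrier B"
begin

interpretation assoc_algebra B by (rule B)

lemma foldr_closed: "foldr (\<lambda>x b. f x \<otimes> b) w \<one> \<in> carrier B"
  by (induction w) (auto simp: f)

text \<open>Multiplying out a word is a monoid homomorphism from lists under concatenation to the
  multiplicative monoid of B; its linear extension is therefore an algebra map.\<close>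

lemma free_lift_algebra_hom: "free_lift B f \<in> algebra_homs free_algebra B"
  unfolding free_lift_def free_algebra_def
proof (rule linear_extension_algebra_hom[OF free_monoid B])
  show "foldr (\<lambda>x b. f x \<otimes> b) (v \<otimes>\<^bsub>free_monoid\<^esub> w) \<one> =
      foldr (\<lambda>x b. f x \<otimes> b) v \<one> \<otimes> foldr (\<lambda>x b. f x \<otimes> b) w \<one>" for v w
    by (induction v) (auto simp: f foldr_closed m_assoc)
qed (auto simp: foldr_closed)

lemma free_lift_gen: "free_lift B f (free_gen x) = f x"
  by (simp add: free_lift_def free_gen_def linear_extension_single f)

end

text \<open>Words are products of generators and monomials are multiples of words, so the algebra
  operations reach every element from the unit and the generators.\<close>

lemma free_algebra_induct [consumes 1, case_names one gen mult add smult]: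
  fixes p :: "'x list \<Rightarrow>\<^sub>0 'k::field"
  defines "F \<equiv> free_algebra :: ('k, 'x list \<Rightarrow>\<^sub>0 'k) module"
  assumes "p \<in> carrier F"
    and "P \<one>\<^bsub>F\<^esub>" and "\<And>x. P (free_gen x)"
    and "\<And>p q. \<lbrakk>p \<in> carrier F; q \<in> carrier F; P p; P q\<rbrakk> \<Longrightarrow> P (p \<otimes>\<^bsub>F\<^esub> q)"
    and "\<And>p q. \<lbrakk>p \<in> carrier F; q \<in> carrier F; P p; P q\<rbrakk> \<Longrightarrow> P (p \<oplus>\<^bsub>F\<^esub> q)"
    and "\<And>c p. \<lbrakk>p \<in> carrier F; P p\<rbrakk> \<Longrightarrow> P (c \<odot>\<^bsub>F\<^esub> p)"
  shows "P p"
proof -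
  interpret assoc_algebra F
    unfolding F_def by (rule free_algebra_assoc_algebra)
  have word: "P (Poly_Mapping.single w 1)" for w
  proof (induction w)
    case Nil
    then show ?case
      using assms(3) by (simp add: F_def free_algebra_def monoid_algebra_simps)
  next
    case (Cons x w)
    have "free_gen x \<otimes>\<^bsub>F\<^esub> Poly_Mapping.single w 1 = Poly_Mapping.single (x # w) 1"
      by (simp add: F_def free_algebra_def free_gen_def monoid_algebra_mult_single)
    moreover have "Poly_Mapping.single w 1 \<in> carrier F"
      by (simp add: F_def free_algebra_def monoid_algebra_simps)
    moreover have "free_gen x \<in> carrier F"
      unfolding F_def by simp
    ultimately show ?case
      using assms(4)[of x] Cons assms(5)[of "free_gen x" "Poly_Mapping.single w 1"] by simp
  qed
  have smult: "P (Poly_Mapping.single w c)" for w c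
    using assms(7)[of "Poly_Mapping.single w 1" c] word[of w]
    by (simp add: F_def free_algebra_def monoid_algebra_simps)
  from assms(2) show ?thesis
    unfolding F_def free_algebra_def
  proof (induction p rule: monoid_algebra_induct)
    case zero
    \<comment> \<open>Zero arises as the multiple by 0 of an arbitrary word, here
      \<open>undefined\<close>.\<close>
    show ?case
      using smult[of undefined 0] by simp
  next
    case (add p q)
    then show ?case
      using assms(6)[of p q] by (simp add: F_def free_algebra_def monoid_algebra_simps(4))
  qed (rule smult)
qed

section \<open>Tensor products\<close>

lemma monoid_algebra_l_diff:
  fixes p q r :: "'g \<Rightarrow>\<^sub>0 'k::field"
  shows "(p - q) \<otimes>\<^bsub>monoid_algebra G\<^esub> r = p \<otimes>\<^bsub>monoid_algebra G\<^esub> r - q \<otimes>\<^bsub>monoid_algebra G\<^esub> r"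
  using monoid_algebra_l_distr[of G "p - q" q r] by simp

lemma monoid_algebra_r_diff:
  fixes p q r :: "'g \<Rightarrow>\<^sub>0 'k::field"
  shows "r \<otimes>\<^bsub>monoid_algebra G\<^esub> (p - q) = r \<otimes>\<^bsub>monoid_algebra G\<^esub> p - r \<otimes>\<^bsub>monoid_algebra G\<^esub> q"
  using monoid_algebra_r_distr[of G r "p - q" q] by simp

lemma monoid_algebra_minus:
  fixes p q :: "'g \<Rightarrow>\<^sub>0 'k::field"
  assumes "monoid G" "p \<in> carrier (monoid_algebra G :: ('k, _) module)"
    "q \<in> carrier (monoid_algebra G :: ('k, _) module)"
  shows "p \<ominus>\<^bsub>monoid_algebra G\<^esub> q = p - q"
proof -
  let ?M = "monoid_algebra G :: ('k, _) module"
  interpret assoc_algebra ?M by (rule monoid_algebra_assoc_algebra) fact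
  have "\<ominus>\<^bsub>?M\<^esub> q = - q"
    by (rule minus_equality) (use assms in \<open>simp_all add: monoid_algebra_simps\<close>)
  then show ?thesis
    by (simp add: a_minus_def monoid_algebra_simps)
qed

definition bilinear_map ::
    "('k::field, 'a, 'm) module_scheme \<Rightarrow> ('k, 'b, 'n) module_scheme \<Rightarrow> ('k, 'c, 'l) module_scheme \<Rightarrow>
     ('a \<Rightarrow> 'b \<Rightarrow> 'c) \<Rightarrow> bool"
  where "bilinear_map A B C \<beta> \<longleftrightarrow>
    (\<forall>y\<in>carrier B. (\<lambda>x. \<beta> x y) \<in> linear_maps A C) \<and> (\<forall>x\<in>carrier A. \<beta> x \<in> linear_maps B C)"

lemma bilinear_mapI:
  assumes "\<And>y. y \<in> carrier B \<Longrightarrow> (\<lambda>x. \<beta> x y) \<in> linear_maps A C"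
    and "\<And>x. x \<in> carrier A \<Longrightarrow> (\<lambda>y. \<beta> x y) \<in> linear_maps B C"
  shows "bilinear_map A B C \<beta>"
  using assms by (simp add: bilinear_map_def)

lemma bilinear_mapD:
  assumes "bilinear_map A B C \<beta>" "x \<in> carrier A" "y \<in> carrier B"
  shows "\<beta> x y \<in> carrier C"
    "\<beta> (c \<odot>\<^bsub>A\<^esub> x) y = c \<odot>\<^bsub>C\<^esub> \<beta> x y" "\<beta> x (c \<odot>\<^bsub>B\<^esub> y) = c \<odot>\<^bsub>C\<^esub> \<beta> x y"
    "x' \<in> carrier A \<Longrightarrow> \<beta> (x \<oplus>\<^bsub>A\<^esub> x') y = \<beta> x y \<oplus>\<^bsub>C\<^esub> \<beta> x' y"
    "y' \<in> carrier B \<Longrightarrow> \<beta> x (y \<oplus>\<^bsub>B\<^esub> y') = \<beta> x y \<oplus>\<^bsub>C\<^esub> \<beta> x y'"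
  using assms by (auto simp: bilinear_map_def linear_maps_def)

locale tensor_product = A: assoc_algebra A + B: assoc_algebra B
  for A :: "('k::field, 'a, 'm) module_scheme" and B :: "('k, 'b, 'n) module_scheme"
begin

abbreviation M :: "('k, 'a \<times> 'b \<Rightarrow>\<^sub>0 'k) module" where "M \<equiv> monoid_algebra (A \<times>\<times> B)"
abbreviation T :: "('k, ('a \<times> 'b \<Rightarrow>\<^sub>0 'k) set) module" where "T \<equiv> tensor A B"
abbreviation pure (infix \<open>\<star>\<close> 75) where "x \<star> y \<equiv> pure_tensor A B x y"

lemma prod_monoid: "monoid (A \<times>\<times> B)"
  by (rule DirProd_monoid) unfold_locales

lemma carrier_prod: "carrier (A \<times>\<times> B) = carrier A \<times> carrier B"
  by (simp add: DirProd_def)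

sublocale M: assoc_algebra M
  by (rule monoid_algebra_assoc_algebra[OF prod_monoid])

lemma single_closed: "\<lbrakk>x \<in> carrier A; y \<in> carrier B\<rbrakk> \<Longrightarrow> Poly_Mapping.single (x, y) c \<in> carrier M"
  by (simp add: monoid_algebra_simps carrier_prod)

lemma carrier_subspace: "scale.subspace (carrier M)"
  using M.add.m_closed M.algebra_smult_closed M.zero_closed
  by (intro scale.subspaceI) (simp_all add: monoid_algebra_simps)

lemma relators_closed: "bilinearity_relators A B \<subseteq> carrier M"
  by (auto simp: bilinearity_relators_def
      intro!: scale.subspace_diff[OF carrier_subspace] single_closed)

lemma subspace_closed: "bilinearity_subspace A B \<subseteq> carrier M"
  unfolding bilinearity_subspace_def
  by (rule scale.span_minimal[OF relators_closed carrier_subspace])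

lemma bilinearity_relators_cases:
  assumes "r \<in> bilinearity_relators A B"
  obtains (add_left) x x' y where "x \<in> carrier A" "x' \<in> carrier A" "y \<in> carrier B"
      "r = Poly_Mapping.single (x \<oplus>\<^bsub>A\<^esub> x', y) 1
       - Poly_Mapping.single (x, y) 1 - Poly_Mapping.single (x', y) 1"
    | (add_right) x y y' where "x \<in> carrier A" "y \<in> carrier B" "y' \<in> carrier B"
      "r = Poly_Mapping.single (x, y \<oplus>\<^bsub>B\<^esub> y') 1
       - Poly_Mapping.single (x, y) 1 - Poly_Mapping.single (x, y') 1"
    | (smult_left) c x y where "x \<in> carrier A" "y \<in> carrier B"
      "r = Poly_Mapping.single (c \<odot>\<^bsub>A\<^esub> x, y) 1 - Poly_Mapping.single (x, y) c"
    | (smult_right) c x y where "x \<in> carrier A" "y \<in> carrier B"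
      "r = Poly_Mapping.single (x, c \<odot>\<^bsub>B\<^esub> y) 1 - Poly_Mapping.single (x, y) c"
proof -
  from assms show ?thesis
    unfolding bilinearity_relators_def
    by (elim UnE CollectE exE conjE) (rule that; assumption)+
qed

lemma relatorsI:
  "\<lbrakk>x \<in> carrier A; x' \<in> carrier A; y \<in> carrier B\<rbrakk> \<Longrightarrow> Poly_Mapping.single (x \<oplus>\<^bsub>A\<^esub> x', y) 1
     - Poly_Mapping.single (x, y) 1 - Poly_Mapping.single (x', y) 1 \<in> bilinearity_relators A B"
  "\<lbrakk>x \<in> carrier A; y \<in> carrier B; y' \<in> carrier B\<rbrakk> \<Longrightarrow> Poly_Mapping.single (x, y \<oplus>\<^bsub>B\<^esub> y') 1
     - Poly_Mapping.single (x, y) 1 - Poly_Mapping.single (x, y') 1 \<in> bilinearity_relators A B"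
  "\<lbrakk>x \<in> carrier A; y \<in> carrier B\<rbrakk> \<Longrightarrow> Poly_Mapping.single (c \<odot>\<^bsub>A\<^esub> x, y) 1 - Poly_Mapping.single (x, y) c
     \<in> bilinearity_relators A B"
  "\<lbrakk>x \<in> carrier A; y \<in> carrier B\<rbrakk> \<Longrightarrow> Poly_Mapping.single (x, c \<odot>\<^bsub>B\<^esub> y) 1 - Poly_Mapping.single (x, y) c
     \<in> bilinearity_relators A B"
  unfolding bilinearity_relators_def by blast+

text \<open>Multiplication by a monomial turns each of the four kinds of relator into a relator of
  the same kind, by distributivity in one component. This is the reason why their span is an ideal
  and the tensor product is an algebra.\<close>

lemma relators_mult:
  assumes "r \<in> bilinearity_relators A B" "x \<in> carrier A" "y \<in> carrier B"
  shows "Poly_Mapping.single (x, y) 1 \<otimes>\<^bsub>M\<^esub> r \<in> bilinearity_relators A B"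
    and "r \<otimes>\<^bsub>M\<^esub> Poly_Mapping.single (x, y) 1 \<in> bilinearity_relators A B"
  using assms(1)
  by (cases rule: bilinearity_relators_cases;
      simp add: monoid_algebra_r_diff monoid_algebra_l_diff monoid_algebra_mult_single assms(2,3)
        A.r_distr A.l_distr B.r_distr B.l_distr A.smult_mult_left A.smult_mult_right
        B.smult_mult_left B.smult_mult_right relatorsI)+

lemma subspace_ideal: "ideal (bilinearity_subspace A B) M"
proof (rule idealI)
  note I_def = bilinearity_subspace_def[of A B]
  let ?I = "bilinearity_subspace A B"
  show "ring M" ..
  show "subgroup ?I (add_monoid M)"
  proof (rule M.add.subgroupI)
    show "?I \<subseteq> carrier M" by (rule subspace_closed)
    show "?I \<noteq> {}" unfolding I_def using scale.span_zero by blast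
    show "\<ominus>\<^bsub>M\<^esub> r \<in> ?I" if "r \<in> ?I" for r
    proof -
      have "\<ominus>\<^bsub>M\<^esub> r = - 1 \<odot>\<^bsub>M\<^esub> r"
        using that subspace_closed by (simp add: M.uminus_smult subset_iff)
      then show ?thesis
        using that unfolding I_def by (simp add: monoid_algebra_simps scale.span_scale scale.span_neg)
    qed
    show "r \<oplus>\<^bsub>M\<^esub> r' \<in> ?I" if "r \<in> ?I" "r' \<in> ?I" for r r'
      using that unfolding I_def monoid_algebra_simps by (rule scale.span_add)
  qed
  fix r p
  assume r: "r \<in> ?I" and p: "p \<in> carrier M"
  \<comment> \<open>For fixed p the elements whose product with p falls into the span form a
    subspace; it therefore suffices to multiply relators, and by linearity in p only by
    monomials.\<close>
  have sub: "scale.subspace {r. p \<otimes>\<^bsub>M\<^esub> r \<in> ?I}" "scale.subspace {r. r \<otimes>\<^bsub>M\<^esub> p \<in> ?I}" for p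
    unfolding I_def
    by (auto intro!: scale.subspaceI scale.span_add scale.span_scale scale.span_zero
        simp: monoid_algebra_r_distr monoid_algebra_l_distr monoid_algebra_smult_left
        monoid_algebra_smult_right)
  have gen: "p \<otimes>\<^bsub>M\<^esub> r \<in> ?I \<and> r \<otimes>\<^bsub>M\<^esub> p \<in> ?I" if r: "r \<in> bilinearity_relators A B" for r
    using p
  proof (induction p rule: monoid_algebra_induct)
    case zero
    show ?case by (simp add: I_def scale.span_zero)
  next
    case (smult x c)
    have eq: "Poly_Mapping.single x c = Poly_Mapping.map ((*) c) (Poly_Mapping.single x 1)"
      by simp
    from smult show ?case
      unfolding eq I_def monoid_algebra_smult_left monoid_algebra_smult_right
      by (auto simp: carrier_prod intro!: scale.span_scale[OF scale.span_base] relators_mult r)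
  next
    case (add p q)
    then show ?case
      by (simp add: I_def monoid_algebra_r_distr monoid_algebra_l_distr scale.span_add)
  qed
  show "p \<otimes>\<^bsub>M\<^esub> r \<in> ?I" "r \<otimes>\<^bsub>M\<^esub> p \<in> ?I"
    using scale.span_minimal[OF _ sub(1)] scale.span_minimal[OF _ sub(2)] gen r
    unfolding I_def by blast+
qed

lemma tensor_assoc_algebra: "assoc_algebra T"
  unfolding tensor_def by (rule M.quotient_assoc_algebra[OF subspace_ideal])

sublocale T: assoc_algebra T
  by (rule tensor_assoc_algebra)

lemma carrier_tensor: "carrier T = (\<lambda>p. bilinearity_subspace A B +>\<^bsub>M\<^esub> p) ` carrier M"
  unfolding tensor_def by (rule M.quotient_carrier[OF subspace_ideal])

lemmas tensor_ops = M.quotient_ops[OF subspace_ideal, folded tensor_def]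
  and tensor_smult = M.quotient_smult[OF subspace_ideal, folded tensor_def]

lemma pure_closed [simp, intro]: "\<lbrakk>x \<in> carrier A; y \<in> carrier B\<rbrakk> \<Longrightarrow> x \<star> y \<in> carrier T"
  by (auto simp: carrier_tensor pure_tensor_def intro: single_closed)

lemma pure_mult:
  assumes "x \<in> carrier A" "y \<in> carrier B" "x' \<in> carrier A" "y' \<in> carrier B"
  shows "(x \<star> y) \<otimes>\<^bsub>T\<^esub> (x' \<star> y') = (x \<otimes>\<^bsub>A\<^esub> x') \<star> (y \<otimes>\<^bsub>B\<^esub> y')"
  using assms
  by (simp add: pure_tensor_def tensor_ops single_closed monoid_algebra_mult_single)

lemma tensor_one: "\<one>\<^bsub>T\<^esub> = \<one>\<^bsub>A\<^esub> \<star> \<one>\<^bsub>B\<^esub>"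
  by (simp add: pure_tensor_def tensor_ops monoid_algebra_simps DirProd_def)

lemma coset_single:
  assumes "x \<in> carrier A" "y \<in> carrier B"
  shows "bilinearity_subspace A B +>\<^bsub>M\<^esub> Poly_Mapping.single (x, y) c = c \<odot>\<^bsub>T\<^esub> (x \<star> y)"
  using assms by (simp add: pure_tensor_def tensor_smult single_closed monoid_algebra_simps)

lemma coset_eqI:
  assumes "p \<in> carrier M" "q \<in> carrier M" "p - q \<in> bilinearity_relators A B"
  shows "bilinearity_subspace A B +>\<^bsub>M\<^esub> p = bilinearity_subspace A B +>\<^bsub>M\<^esub> q"
proof -
  have "p - q \<in> bilinearity_subspace A B"
    unfolding bilinearity_subspace_def using assms(3) by (rule scale.span_base)
  then show ?thesis
    using assms(1,2)
    by (simp add: M.coset_eq_iff[OF subspace_ideal] monoid_algebra_minus[OF prod_monoid])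
qed

text \<open>Each identity is one kind of relator read modulo the span. For the scalar identities, a
  multiple of a pure tensor is first rewritten as the coset of a monomial with that coefficient,
  which is the form the relators use.\<close>

lemma pure_bilinear: "bilinear_map A B T (\<star>)"
proof (intro bilinear_mapI linear_mapsI)
  fix x y assume xy: "x \<in> carrier A" "y \<in> carrier B"
  show "x \<star> y \<in> carrier T" "x \<star> y \<in> carrier T"
    using xy by auto
  show "(c \<odot>\<^bsub>A\<^esub> x) \<star> y = c \<odot>\<^bsub>T\<^esub> (x \<star> y)" for c
    unfolding coset_single[OF xy, symmetric] unfolding pure_tensor_def
    by (rule coset_eqI) (use xy in \<open>simp_all add: single_closed relatorsI\<close>)
  show "x \<star> (c \<odot>\<^bsub>B\<^esub> y) = c \<odot>\<^bsub>T\<^esub> (x \<star> y)" for c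
    unfolding coset_single[OF xy, symmetric] unfolding pure_tensor_def
    by (rule coset_eqI) (use xy in \<open>simp_all add: single_closed relatorsI\<close>)
next
  fix x x' y assume xy: "x \<in> carrier A" "x' \<in> carrier A" "y \<in> carrier B"
  have "bilinearity_subspace A B +>\<^bsub>M\<^esub> Poly_Mapping.single (x \<oplus>\<^bsub>A\<^esub> x', y) 1 =
      bilinearity_subspace A B +>\<^bsub>M\<^esub> (Poly_Mapping.single (x, y) 1 \<oplus>\<^bsub>M\<^esub> Poly_Mapping.single (x', y) 1)"
    by (rule coset_eqI)
      (use xy relatorsI(1)[OF xy] in \<open>simp_all add: single_closed, simp add: monoid_algebra_simps diff_diff_add\<close>)
  then show "(x \<oplus>\<^bsub>A\<^esub> x') \<star> y = (x \<star> y) \<oplus>\<^bsub>T\<^esub> (x' \<star> y)"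
    using xy by (simp add: pure_tensor_def tensor_ops single_closed)
next
  fix x y y' assume xy: "x \<in> carrier A" "y \<in> carrier B" "y' \<in> carrier B"
  have "bilinearity_subspace A B +>\<^bsub>M\<^esub> Poly_Mapping.single (x, y \<oplus>\<^bsub>B\<^esub> y') 1 =
      bilinearity_subspace A B +>\<^bsub>M\<^esub> (Poly_Mapping.single (x, y) 1 \<oplus>\<^bsub>M\<^esub> Poly_Mapping.single (x, y') 1)"
    by (rule coset_eqI)
      (use xy relatorsI(2)[OF xy] in \<open>simp_all add: single_closed, simp add: monoid_algebra_simps diff_diff_add\<close>)
  then show "x \<star> (y \<oplus>\<^bsub>B\<^esub> y') = (x \<star> y) \<oplus>\<^bsub>T\<^esub> (x \<star> y')"
    using xy by (simp add: pure_tensor_def tensor_ops single_closed)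
qed

lemma pure_uminus:
  assumes "x \<in> carrier A" "y \<in> carrier B"
  shows "(\<ominus>\<^bsub>A\<^esub> x) \<star> y = \<ominus>\<^bsub>T\<^esub> (x \<star> y)" "x \<star> (\<ominus>\<^bsub>B\<^esub> y) = \<ominus>\<^bsub>T\<^esub> (x \<star> y)"
  using bilinear_mapD(2,3)[OF pure_bilinear assms, of "- 1"] assms
  by (simp_all add: A.uminus_smult B.uminus_smult T.uminus_smult)

lemma pure_minus:
  "\<lbrakk>x \<in> carrier A; x' \<in> carrier A; y \<in> carrier B\<rbrakk> \<Longrightarrow> (x \<ominus>\<^bsub>A\<^esub> x') \<star> y = (x \<star> y) \<ominus>\<^bsub>T\<^esub> (x' \<star> y)"
  "\<lbrakk>x \<in> carrier A; y \<in> carrier B; y' \<in> carrier B\<rbrakk> \<Longrightarrow> x \<star> (y \<ominus>\<^bsub>B\<^esub> y') = (x \<star> y) \<ominus>\<^bsub>T\<^esub> (x \<star> y')"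
  by (simp_all add: a_minus_def pure_uminus bilinear_mapD[OF pure_bilinear])

lemma pure_nat_pow:
  assumes "x \<in> carrier A" "y \<in> carrier B"
  shows "(x \<star> y) [^]\<^bsub>T\<^esub> (n :: nat) = (x [^]\<^bsub>A\<^esub> n) \<star> (y [^]\<^bsub>B\<^esub> n)"
  by (induction n) (simp_all add: assms tensor_one pure_mult)

lemmas pure_add = bilinear_mapD(4,5)[OF pure_bilinear]
  and pure_smult = bilinear_mapD(2,3)[OF pure_bilinear]

text \<open>Since c (x \<otimes> y) = (c x) \<otimes> y is again pure, every tensor is a sum of pure
  tensors, and no case for scalar multiples has to be checked.\<close>

lemma tensor_induct [consumes 1, case_names pure add]:
  assumes "t \<in> carrier T"
    and pure: "\<And>x y. \<lbrakk>x \<in> carrier A; y \<in> carrier B\<rbrakk> \<Longrightarrow> P (x \<star> y)"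
    and add: "\<And>t u. \<lbrakk>t \<in> carrier T; u \<in> carrier T; P t; P u\<rbrakk> \<Longrightarrow> P (t \<oplus>\<^bsub>T\<^esub> u)"
  shows "P t"
proof -
  have single: "P (bilinearity_subspace A B +>\<^bsub>M\<^esub> Poly_Mapping.single (x, y) c)"
    if "x \<in> carrier A" "y \<in> carrier B" for x y c
    using pure[of "c \<odot>\<^bsub>A\<^esub> x" y] that
    by (simp add: coset_single bilinear_mapD(2)[OF pure_bilinear])
  from assms(1) obtain p where p: "p \<in> carrier M" "t = bilinearity_subspace A B +>\<^bsub>M\<^esub> p"
    by (auto simp: carrier_tensor)
  from p(1) have "P (bilinearity_subspace A B +>\<^bsub>M\<^esub> p)"
  proof (induction p rule: monoid_algebra_induct)
    case zero
    show ?case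
      using single[of "\<zero>\<^bsub>A\<^esub>" "\<zero>\<^bsub>B\<^esub>" 0] by simp
  next
    case (smult x c)
    then show ?case using single by (cases x) (simp add: carrier_prod)
  next
    case (add p q)
    then show ?case
      using assms(3)[of "bilinearity_subspace A B +>\<^bsub>M\<^esub> p" "bilinearity_subspace A B +>\<^bsub>M\<^esub> q"]
      by (simp add: tensor_ops carrier_tensor monoid_algebra_simps(4))
  qed
  with p show ?thesis by simp
qed

section \<open>The universal property of the tensor product\<close>

context
  fixes C :: "('k, 'c, 'l) module_scheme" and \<beta> :: "'a \<Rightarrow> 'b \<Rightarrow> 'c"
  assumes C: "assoc_algebra C" and \<beta>: "bilinear_map A B C \<beta>"
begin

interpretation C: assoc_algebra C by (rule C)

private abbreviation (input) "ext \<equiv> linear_extension C (\<lambda>(a, b). \<beta> a b)"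

lemma ext_linear: "ext \<in> linear_maps M C"
  by (rule C.linear_extension_linear) (auto simp: carrier_prod bilinear_mapD(1)[OF \<beta>])

interpretation ext: linear_map M C ext
  by unfold_locales (rule ext_linear)

lemma ext_single: "\<lbrakk>x \<in> carrier A; y \<in> carrier B\<rbrakk> \<Longrightarrow> ext (Poly_Mapping.single (x, y) c) = c \<odot>\<^bsub>C\<^esub> \<beta> x y"
  by (simp add: C.linear_extension_single bilinear_mapD(1)[OF \<beta>])

lemma ext_diff: "\<lbrakk>p \<in> carrier M; q \<in> carrier M\<rbrakk> \<Longrightarrow> ext (p - q) = ext p \<ominus>\<^bsub>C\<^esub> ext q"
  using ext.map_minus[of p q] by (simp add: monoid_algebra_minus[OF prod_monoid])

text \<open>Bilinearity of \<beta> says precisely that the linear extension sends relators to zero;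
  the kernel being a subspace, it then contains their whole span.\<close>

lemma ext_relator:
  assumes "r \<in> bilinearity_relators A B"
  shows "ext r = \<zero>\<^bsub>C\<^esub>"
proof -
  note closed = single_closed scale.subspace_diff[OF carrier_subspace] bilinear_mapD(1)[OF \<beta>]
  have cancel: "u \<oplus>\<^bsub>C\<^esub> v \<ominus>\<^bsub>C\<^esub> u \<ominus>\<^bsub>C\<^esub> v = \<zero>\<^bsub>C\<^esub>" if "u \<in> carrier C" "v \<in> carrier C" for u v
  proof -
    have "u \<oplus>\<^bsub>C\<^esub> v \<ominus>\<^bsub>C\<^esub> u \<ominus>\<^bsub>C\<^esub> v = (u \<oplus>\<^bsub>C\<^esub> v) \<ominus>\<^bsub>C\<^esub> (u \<oplus>\<^bsub>C\<^esub> v)"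
      using that by (simp add: a_minus_def C.a_assoc C.minus_add)
    with that show ?thesis by (simp add: C.r_right_minus_eq)
  qed
  from assms show ?thesis
    by (cases rule: bilinearity_relators_cases)
      (simp_all add: ext_diff closed ext_single bilinear_mapD[OF \<beta>] cancel C.r_right_minus_eq)
qed

lemma ext_subspace:
  assumes "r \<in> bilinearity_subspace A B"
  shows "ext r = \<zero>\<^bsub>C\<^esub>"
proof -
  have "scale.subspace {r \<in> carrier M. ext r = \<zero>\<^bsub>C\<^esub>}"
    using ext.map_add ext.map_smult ext.map_zero scale.subspace_add[OF carrier_subspace]
      scale.subspace_scale[OF carrier_subspace] scale.subspace_0[OF carrier_subspace]
    by (intro scale.subspaceI) (auto simp: monoid_algebra_simps(3-5))
  moreover have "bilinearity_relators A B \<subseteq> {r \<in> carrier M. ext r = \<zero>\<^bsub>C\<^esub>}"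
    using relators_closed ext_relator by blast
  ultimately show ?thesis
    using assms scale.span_minimal unfolding bilinearity_subspace_def by blast
qed

lemma tensor_lift_linear: "tensor_lift C \<beta> \<in> linear_maps T C"
  unfolding tensor_lift_def tensor_def
  by (rule M.induced_map_linear[OF subspace_ideal C ext_linear ext_subspace])

lemma tensor_lift_pure:
  assumes "x \<in> carrier A" "y \<in> carrier B"
  shows "tensor_lift C \<beta> (x \<star> y) = \<beta> x y"
  unfolding tensor_lift_def pure_tensor_def
  using assms
  by (subst M.induced_map_coset[OF subspace_ideal C ext_linear ext_subspace])
    (simp_all add: single_closed ext_single bilinear_mapD(1)[OF \<beta>])

text \<open>The product formula is additive in both tensors, so it follows from pure tensors by
  induction on the right factor and then on the left one.\<close>

lemma tensor_lift_algebra_hom: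
  assumes mult: "\<And>x y x' y'. \<lbrakk>x \<in> carrier A; y \<in> carrier B; x' \<in> carrier A; y' \<in> carrier B\<rbrakk> \<Longrightarrow>
      \<beta> (x \<otimes>\<^bsub>A\<^esub> x') (y \<otimes>\<^bsub>B\<^esub> y') = \<beta> x y \<otimes>\<^bsub>C\<^esub> \<beta> x' y'"
    and one: "\<beta> \<one>\<^bsub>A\<^esub> \<one>\<^bsub>B\<^esub> = \<one>\<^bsub>C\<^esub>"
  shows "tensor_lift C \<beta> \<in> algebra_homs T C"
proof (rule algebra_homsI[OF tensor_lift_linear])
  note lin = linear_mapsD[OF tensor_lift_linear]
  let ?l = "tensor_lift C \<beta>"
  have 1: "?l ((x \<star> y) \<otimes>\<^bsub>T\<^esub> u) = \<beta> x y \<otimes>\<^bsub>C\<^esub> ?l u"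
    if "x \<in> carrier A" "y \<in> carrier B" "u \<in> carrier T" for x y u
    using that(3)
    by (induction u rule: tensor_induct)
      (use that(1,2) in \<open>simp_all add: pure_mult tensor_lift_pure mult T.r_distr C.r_distr lin
        bilinear_mapD(1)[OF \<beta>]\<close>)
  show "?l (t \<otimes>\<^bsub>T\<^esub> u) = ?l t \<otimes>\<^bsub>C\<^esub> ?l u" if "t \<in> carrier T" "u \<in> carrier T" for t u
    using that(1)
    by (induction t rule: tensor_induct)
      (use that(2) in \<open>simp_all add: 1 tensor_lift_pure T.l_distr C.l_distr lin\<close>)
  show "?l \<one>\<^bsub>T\<^esub> = \<one>\<^bsub>C\<^esub>"
    by (simp add: tensor_one tensor_lift_pure one)
qed

end

end

section \<open>Tensor products of maps\<close>

locale tensor_product2 = AB: tensor_product A B + CD: tensor_product C D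
  for A :: "('k::field, 'a, 'm) module_scheme" and B :: "('k, 'b, 'n) module_scheme"
    and C :: "('k, 'c, 'r) module_scheme" and D :: "('k, 'd, 's) module_scheme"
begin

lemma tensor_map_bilinear:
  assumes f: "f \<in> linear_maps A C" and g: "g \<in> linear_maps B D"
  shows "bilinear_map A B (tensor C D) (\<lambda>a b. pure_tensor C D (f a) (g b))"
  by (intro bilinear_mapI linear_mapsI)
    (simp_all add: linear_mapsD[OF f] linear_mapsD[OF g] bilinear_mapD[OF CD.pure_bilinear])

lemma tensor_map_pure:
  assumes "f \<in> linear_maps A C" "g \<in> linear_maps B D" "x \<in> carrier A" "y \<in> carrier B"
  shows "tensor_map C D f g (pure_tensor A B x y) = pure_tensor C D (f x) (g y)"
  unfolding tensor_map_def
  using AB.tensor_lift_pure[OF CD.tensor_assoc_algebra tensor_map_bilinear[OF assms(1,2)] assms(3,4)] .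

lemma tensor_map_algebra_hom:
  assumes f: "f \<in> algebra_homs A C" and g: "g \<in> algebra_homs B D"
  shows "tensor_map C D f g \<in> algebra_homs (tensor A B) (tensor C D)"
  unfolding tensor_map_def
  by (rule AB.tensor_lift_algebra_hom[OF CD.tensor_assoc_algebra tensor_map_bilinear])
    (simp_all add: algebra_homsD[OF f] algebra_homsD[OF g] linear_mapsD(1)[OF algebra_homsD(1)[OF f]]
      linear_mapsD(1)[OF algebra_homsD(1)[OF g]] CD.pure_mult CD.tensor_one)

end

section \<open>The associativity isomorphism of tensor products\<close>

context assoc_algebra
begin

interpretation AA: tensor_product A A by unfold_locales
interpretation AAA: tensor_product A "tensor A A" by unfold_locales
interpretation AA_A: tensor_product "tensor A A" A by unfold_locales

abbreviation "triple a b c \<equiv> pure_tensor A (tensor A A) a (pure_tensor A A b c)"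

lemma assoc_bilinear_inner:
  assumes "c \<in> carrier A"
  shows "bilinear_map A A (tensor A (tensor A A)) (\<lambda>a b. triple a b c)"
  using assms
  by (intro bilinear_mapI linear_mapsI)
    (simp_all add: bilinear_mapD[OF AA.pure_bilinear] bilinear_mapD[OF AAA.pure_bilinear])

lemmas assoc_lift_pure = AA.tensor_lift_pure[OF AAA.tensor_assoc_algebra assoc_bilinear_inner]
  and assoc_lift_linear = AA.tensor_lift_linear[OF AAA.tensor_assoc_algebra assoc_bilinear_inner]

text \<open>Linearity in t is built into the inner lift. Linearity in c is not, because c is a
  parameter of the bilinear map being lifted; it is obtained by induction on t.\<close>

lemma assoc_bilinear:
  "bilinear_map (tensor A A) A (tensor A (tensor A A))
    (\<lambda>t c. tensor_lift (tensor A (tensor A A)) (\<lambda>a b. triple a b c) t)" (is "bilinear_map _ _ ?C ?L")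
proof (rule bilinear_mapI)
  show "(\<lambda>t. ?L t c) \<in> linear_maps (tensor A A) ?C" if "c \<in> carrier A" for c
    by (rule assoc_lift_linear[OF that])
  fix t assume t: "t \<in> carrier (tensor A A)"
  note closed = linear_mapsD(1)[OF assoc_lift_linear] and add = linear_mapsD(3)[OF assoc_lift_linear]
  show "?L t \<in> linear_maps A ?C"
  proof (rule linear_mapsI)
    show "?L t c \<in> carrier ?C" if "c \<in> carrier A" for c
      using that t by (rule closed)
    show "?L t (c \<oplus> d) = ?L t c \<oplus>\<^bsub>?C\<^esub> ?L t d" if "c \<in> carrier A" "d \<in> carrier A" for c d
      using t
    proof (induction t rule: AA.tensor_induct)
      case (pure x y)
      then show ?case
        using that by (simp add: assoc_lift_pure bilinear_mapD[OF AA.pure_bilinear] bilinear_mapD[OF AAA.pure_bilinear])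
    next
      case (add t u)
      then show ?case
        using that by (simp add: linear_mapsD(3)[OF assoc_lift_linear] closed AAA.T.a_ac)
    qed
    show "?L t (k \<odot> c) = k \<odot>\<^bsub>?C\<^esub> ?L t c" if "c \<in> carrier A" for k c
      using t
    proof (induction t rule: AA.tensor_induct)
      case (pure x y)
      then show ?case
        using that by (simp add: assoc_lift_pure bilinear_mapD[OF AA.pure_bilinear] bilinear_mapD[OF AAA.pure_bilinear])
    next
      case (add t u)
      then show ?case
        using that by (simp add: linear_mapsD(3)[OF assoc_lift_linear] closed AAA.T.smult_add)
    qed
  qed
qed

lemma tensor_assoc_pure:
  assumes "t \<in> carrier (tensor A A)" "c \<in> carrier A"
  shows "tensor_assoc A (pure_tensor (tensor A A) A t c) =
    tensor_lift (tensor A (tensor A A)) (\<lambda>a b. triple a b c) t"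
  unfolding tensor_assoc_def
  by (rule AA_A.tensor_lift_pure[OF AAA.tensor_assoc_algebra assoc_bilinear assms])

lemma tensor_assoc_pure_pure:
  assumes "a \<in> carrier A" "b \<in> carrier A" "c \<in> carrier A"
  shows "tensor_assoc A (pure_tensor (tensor A A) A (pure_tensor A A a b) c) = triple a b c"
  using assms by (simp add: tensor_assoc_pure assoc_lift_pure)

text \<open>On pure tensors both products are componentwise and rebracketing preserves the
  components; the nested tensor is reduced to pure ones in one factor at a time.\<close>

lemma tensor_assoc_algebra_hom:
  "tensor_assoc A \<in> algebra_homs (tensor (tensor A A) A) (tensor A (tensor A A))"
  unfolding tensor_assoc_def
proof (rule AA_A.tensor_lift_algebra_hom[OF AAA.tensor_assoc_algebra assoc_bilinear])
  let ?C = "tensor A (tensor A A)"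
  let ?L = "\<lambda>t c. tensor_lift ?C (\<lambda>a b. triple a b c) t"
  note closed = linear_mapsD(1)[OF assoc_lift_linear] and lin = linear_mapsD(3)[OF assoc_lift_linear]
  have 1: "?L (pure_tensor A A x y \<otimes>\<^bsub>tensor A A\<^esub> u) (c \<otimes> d) = triple x y c \<otimes>\<^bsub>?C\<^esub> ?L u d"
    if "x \<in> carrier A" "y \<in> carrier A" "u \<in> carrier (tensor A A)" "c \<in> carrier A" "d \<in> carrier A"
    for x y u c d
    using that(3)
    by (induction u rule: AA.tensor_induct)
      (use that in \<open>simp_all add: AA.pure_mult AAA.pure_mult assoc_lift_pure closed lin AA.T.r_distr
        AAA.T.r_distr\<close>)
  show "?L (t \<otimes>\<^bsub>tensor A A\<^esub> u) (c \<otimes> d) = ?L t c \<otimes>\<^bsub>?C\<^esub> ?L u d"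
    if "t \<in> carrier (tensor A A)" "c \<in> carrier A" "u \<in> carrier (tensor A A)" "d \<in> carrier A" for t c u d
    using that(1)
    by (induction t rule: AA.tensor_induct)
      (use that in \<open>simp_all add: 1 assoc_lift_pure closed lin AA.T.l_distr AAA.T.l_distr\<close>)
  show "?L \<one>\<^bsub>tensor A A\<^esub> \<one> = \<one>\<^bsub>?C\<^esub>"
    by (simp add: AA.tensor_one AAA.tensor_one assoc_lift_pure)
qed

end

section \<open>The algebra \<open>H\<^sub>\<lambda>\<close>\<close>

locale algebra_hom = linear_map A B f
  for A :: "('k::field, 'a, 'm) module_scheme" (structure)
    and B :: "('k, 'b, 'n) module_scheme" and f +
  assumes hom: "f \<in> algebra_homs A B"
begin

lemmas map_one [simp] = algebra_homsD(2)[OF hom]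
  and map_mult = algebra_homsD(3)[OF hom]

lemma map_nat_pow: "x \<in> carrier A \<Longrightarrow> f (x [^] (n :: nat)) = f x [^]\<^bsub>B\<^esub> n"
  by (induction n) (simp_all add: map_mult)

end

lemma algebra_homI:
  assumes "assoc_algebra A" "assoc_algebra B" "f \<in> algebra_homs A B"
  shows "algebra_hom A B f"
  using assms algebra_homsD(1)[OF assms(3)]
  by (intro algebra_hom.intro linear_map.intro linear_map_axioms.intro algebra_hom_axioms.intro)

text \<open>
  The last relation is kept apart because it is checked in the equivalent form given by
  \<open>last_relation_iff\<close> below, which presupposes the relations in \<open>skew_quadruple\<close>.
\<close>

locale skew_quadruple = assoc_algebra B
  for B :: "('k::field, 'b, 'm) module_scheme" (structure)
    and l1 l2 :: 'k and g1 g2 a1 a2 :: 'b +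
  assumes closed [simp]: "g1 \<in> carrier B" "g2 \<in> carrier B" "a1 \<in> carrier B" "a2 \<in> carrier B"
    and g1_g2: "g1 \<otimes> g2 = g2 \<otimes> g1"
    and g1_a1: "g1 \<otimes> a1 = \<ominus> (a1 \<otimes> g1)"
    and g1_a2: "g1 \<otimes> a2 = \<ominus> (a2 \<otimes> g1)"
    and g2_a1: "g2 \<otimes> a1 = a1 \<otimes> g2"
    and g2_a2: "g2 \<otimes> a2 = \<ominus> (a2 \<otimes> g2)"
    and a1_a1: "a1 \<otimes> a1 = l1 \<odot> (\<one> \<ominus> g1 \<otimes> g1)"
    and a2_a2: "a2 \<otimes> a2 = l2 \<odot> (\<one> \<ominus> g2 \<otimes> g2)"

text \<open>Such quadruples in B are the same thing as algebra maps from H to B: they are the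
  admissible images of the four generators.\<close>

locale H_quadruple = skew_quadruple B l1 l2 g1 g2 a1 a2
  for B :: "('k::field, 'b, 'm) module_scheme" (structure)
    and l1 l2 :: 'k and g1 g2 a1 a2 :: 'b +
  fixes l3 :: 'k and N M :: nat
  assumes g1_order: "g1 [^] (2 * N) = \<one>" and g2_order: "g2 [^] (2 * M) = \<one>"
    and last_relation: "a1 \<otimes> a2 \<otimes> a1 \<otimes> a2 \<oplus> a2 \<otimes> a1 \<otimes> a2 \<otimes> a1 =
      l3 \<odot> (\<one> \<ominus> (g1 \<otimes> g1) \<otimes> (g2 \<otimes> g2)) \<ominus>
      (2 * l1 * l2) \<odot> ((\<one> \<oplus> g2 \<otimes> g2) \<otimes> (\<one> \<ominus> g1 \<otimes> g1))"

lemma carrier_free_algebra [simp]: "carrier free_algebra = UNIV"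
  by (simp add: free_algebra_def monoid_algebra_simps)

context
  fixes N M :: nat and l1 l2 l3 :: "'k::field"
begin

private abbreviation (input) "F \<equiv> free_algebra :: ('k, gen list \<Rightarrow>\<^sub>0 'k) module"
private abbreviation (input) "I \<equiv> H_ideal N M l1 l2 l3"
private abbreviation (input) "HA \<equiv> H_alg N M l1 l2 l3"
private abbreviation (input) "quot_gen \<equiv> H_gen N M l1 l2 l3"

interpretation F: assoc_algebra F by (rule free_algebra_assoc_algebra)

lemma H_ideal: "ideal I F"
  unfolding H_ideal_def by (rule F.genideal_ideal) simp

text \<open>Used in both directions: for the coset map it shows that the generators of the quotient
  satisfy the relations, and for a map prescribed on generators it shows that the relators are
  respected.\<close>

lemma relations_iff_quadruple:
  assumes "algebra_hom F B f"
  shows "(\<forall>(l, r) \<in> H_relations N M l1 l2 l3. f l = f r) \<longleftrightarrow>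
    H_quadruple B l1 l2 (f (free_gen G1)) (f (free_gen G2)) (f (free_gen A1)) (f (free_gen A2)) l3 N M"
proof -
  interpret algebra_hom F B f by fact
  have sq: "x [^]\<^bsub>F\<^esub> (2::nat) = x \<otimes>\<^bsub>F\<^esub> x" for x
    using F.nat_pow_Suc[of x 1] by (simp add: numeral_2_eq_2)
  show ?thesis
    unfolding H_quadruple_def skew_quadruple_def skew_quadruple_axioms_def H_quadruple_axioms_def
    by (simp add: H_relations_def Let_def sq map_mult map_add map_minus map_uminus map_smult
        map_nat_pow B.assoc_algebra_axioms)
      (rule iffI; elim conjE; intro conjI; assumption)
qed

lemma H_alg_assoc_algebra: "assoc_algebra HA"
  unfolding H_alg_def by (rule F.quotient_assoc_algebra[OF H_ideal])

lemma coset_hom: "algebra_hom F HA (\<lambda>p. I +>\<^bsub>F\<^esub> p)"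
  using F.coset_algebra_hom[OF H_ideal] H_alg_assoc_algebra F.assoc_algebra_axioms
  by (intro algebra_homI) (simp_all add: H_alg_def)

lemma H_gen_quadruple: "H_quadruple HA l1 l2 (quot_gen G1) (quot_gen G2) (quot_gen A1) (quot_gen A2) l3 N M"
proof -
  have "I +>\<^bsub>F\<^esub> l = I +>\<^bsub>F\<^esub> r" if "(l, r) \<in> H_relations N M l1 l2 l3" for l r
  proof -
    have "l \<ominus>\<^bsub>F\<^esub> r \<in> I"
      unfolding H_ideal_def using that by (intro subsetD[OF F.genideal_self]) auto
    then show ?thesis by (simp add: F.coset_eq_iff[OF H_ideal])
  qed
  then show ?thesis
    using relations_iff_quadruple[OF coset_hom] by (auto simp: H_gen_def)
qed

section \<open>The universal property of the presented algebra\<close>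

context
  fixes B :: "('k, 'b, 'm) module_scheme" and f :: "gen \<Rightarrow> 'b"
  assumes f: "H_quadruple B l1 l2 (f G1) (f G2) (f A1) (f A2) l3 N M"
begin

interpretation H_quadruple B l1 l2 "f G1" "f G2" "f A1" "f A2" l3 N M by (rule f)

lemma gen_closed: "f x \<in> carrier B"
  by (cases x) simp_all

lemma free_lift_hom: "algebra_hom F B (free_lift B f)"
  by (intro algebra_homI free_lift_algebra_hom F.assoc_algebra_axioms assoc_algebra_axioms gen_closed)

interpretation lift: algebra_hom F B "free_lift B f" by (rule free_lift_hom)

text \<open>The kernel of the lift is an ideal containing the differences l - r of all relations,
  hence contains the ideal they generate.\<close>

lemma free_lift_H_ideal:
  assumes "p \<in> I"
  shows "free_lift B f p = \<zero>\<^bsub>B\<^esub>"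
proof -
  let ?g = "free_lift B f"
  have rel: "?g l = ?g r" if "(l, r) \<in> H_relations N M l1 l2 l3" for l r
    using that relations_iff_quadruple[OF free_lift_hom] f
    by (auto simp: free_lift_gen[OF assoc_algebra_axioms gen_closed])
  have "ring_hom_ring F B ?g"
    using lift.hom by (intro ring_hom_ringI2) (auto simp: algebra_homs_def intro: F.ring_axioms ring_axioms)
  then have "ideal (a_kernel F B ?g) F"
    by (rule ring_hom_ring.kernel_is_ideal)
  moreover have "{l \<ominus>\<^bsub>F\<^esub> r | l r. (l, r) \<in> H_relations N M l1 l2 l3} \<subseteq> a_kernel F B ?g"
    using rel by (auto simp: a_kernel_def' lift.map_minus r_right_minus_eq)
  ultimately have "I \<subseteq> a_kernel F B ?g"
    unfolding H_ideal_def by (rule F.genideal_minimal)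
  with assms show ?thesis
    by (auto simp: a_kernel_def')
qed

lemma H_lift_algebra_hom: "induced_map (free_lift B f) \<in> algebra_homs HA B"
  unfolding H_alg_def
  by (rule F.induced_map_algebra_hom[OF H_ideal assoc_algebra_axioms lift.hom free_lift_H_ideal])

lemma H_lift_gen: "induced_map (free_lift B f) (quot_gen x) = f x"
  unfolding H_gen_def
  by (subst F.induced_map_coset[OF H_ideal assoc_algebra_axioms lift.linear free_lift_H_ideal])
    (simp_all add: free_lift_gen[OF assoc_algebra_axioms gen_closed])

end

text \<open>Every element is the coset of a noncommutative polynomial, so induction over the free
  algebra is transported along the coset map.\<close>

lemma H_induct [consumes 1, case_names one gen mult add smult]:
  assumes "x \<in> carrier HA"
    and "P \<one>\<^bsub>HA\<^esub>" and "\<And>x. P (quot_gen x)"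
    and "\<And>x y. \<lbrakk>x \<in> carrier HA; y \<in> carrier HA; P x; P y\<rbrakk> \<Longrightarrow> P (x \<otimes>\<^bsub>HA\<^esub> y)"
    and "\<And>x y. \<lbrakk>x \<in> carrier HA; y \<in> carrier HA; P x; P y\<rbrakk> \<Longrightarrow> P (x \<oplus>\<^bsub>HA\<^esub> y)"
    and "\<And>c x. \<lbrakk>x \<in> carrier HA; P x\<rbrakk> \<Longrightarrow> P (c \<odot>\<^bsub>HA\<^esub> x)"
  shows "P x"
proof -
  interpret algebra_hom F HA "\<lambda>p. I +>\<^bsub>F\<^esub> p" by (rule coset_hom)
  from assms(1) obtain p where p: "p \<in> carrier F" "x = I +>\<^bsub>F\<^esub> p"
    unfolding H_alg_def F.quotient_carrier[OF H_ideal] by blast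
  from p(1) have "P (I +>\<^bsub>F\<^esub> p)"
  proof (induction p rule: free_algebra_induct)
    case one
    show ?case using assms(2) by simp
  next
    case (gen x)
    show ?case using assms(3) by (simp add: H_gen_def)
  next
    case (mult p q)
    then show ?case using map_closed by (simp add: map_mult assms(4))
  next
    case (add p q)
    then show ?case using map_closed by (simp add: map_add assms(5))
  next
    case (smult c p)
    then show ?case using map_closed by (simp add: map_smult assms(6))
  qed
  with p show ?thesis by simp
qed

lemma H_hom_eqI:
  assumes f: "f \<in> algebra_homs HA B" and g: "g \<in> algebra_homs HA B"
    and "\<And>x. f (quot_gen x) = g (quot_gen x)" and "x \<in> carrier HA"
  shows "f x = g x"
  using assms(4)
proof (induction x rule: H_induct)
  case one
  show ?case by (simp add: algebra_homsD(2)[OF f] algebra_homsD(2)[OF g])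
next
  case (mult x y)
  then show ?case by (simp add: algebra_homsD(3)[OF f] algebra_homsD(3)[OF g])
next
  case (add x y)
  then show ?case
    by (simp add: linear_mapsD(3)[OF algebra_homsD(1)[OF f]] linear_mapsD(3)[OF algebra_homsD(1)[OF g]])
next
  case (smult c x)
  then show ?case
    by (simp add: linear_mapsD(2)[OF algebra_homsD(1)[OF f]] linear_mapsD(2)[OF algebra_homsD(1)[OF g]])
qed (rule assms(3))

end

section \<open>Consequences of the relations\<close>

context ring
begin

text \<open>Serves the two cancellations in the tensor square: that of k \<otimes> 1 in the
  coproduct of 1 - k, and that of the cross term in the last relation.\<close>

lemma telescope:
  "\<lbrakk>x \<in> carrier R; y \<in> carrier R; z \<in> carrier R\<rbrakk> \<Longrightarrow> (x \<ominus> y) \<oplus> (y \<ominus> z) = x \<ominus> z"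
  by (simp add: a_minus_def a_assoc r_neg1)

lemma anticommute_square:
  assumes "x \<in> carrier R" "y \<in> carrier R" "x \<otimes> y = \<ominus> (y \<otimes> x)"
  shows "(x \<oplus> y) \<otimes> (x \<oplus> y) = x \<otimes> x \<oplus> y \<otimes> y"
proof -
  have "(x \<oplus> y) \<otimes> (x \<oplus> y) = x \<otimes> x \<oplus> x \<otimes> y \<oplus> y \<otimes> x \<oplus> y \<otimes> y"
    using assms(1,2) by (simp add: l_distr r_distr a_ac)
  also have "\<dots> = x \<otimes> x \<oplus> (\<ominus> (y \<otimes> x) \<oplus> y \<otimes> x) \<oplus> y \<otimes> y"
    using assms by (simp add: a_ac)
  finally show ?thesis
    using assms(1,2) by (simp add: l_neg)
qed

lemma anticommute_square3:
  assumes "x \<in> carrier R" "y \<in> carrier R" "z \<in> carrier R"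
    and "x \<otimes> y = \<ominus> (y \<otimes> x)" "x \<otimes> z = \<ominus> (z \<otimes> x)" "y \<otimes> z = \<ominus> (z \<otimes> y)"
  shows "(x \<oplus> y \<oplus> z) \<otimes> (x \<oplus> y \<oplus> z) = x \<otimes> x \<oplus> y \<otimes> y \<oplus> z \<otimes> z"
proof -
  \<comment> \<open>The sum x + y anticommutes with z as well, so the case of two summands applies
    twice.\<close>
  have "(x \<oplus> y) \<otimes> z = \<ominus> (z \<otimes> (x \<oplus> y))"
    using assms by (simp add: l_distr r_distr minus_add)
  then show ?thesis
    using assms by (simp add: anticommute_square)
qed

end

context skew_quadruple
begin

text \<open>Oriented as rewrite rules that collect the group elements on the left, g1 before g2.
  Together with \<open>reorder_left\<close>, which acts inside right-nested products, they sort
  group elements to the left of the a_i.\<close>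

lemma reorder:
  "g2 \<otimes> g1 = g1 \<otimes> g2" "a1 \<otimes> g1 = \<ominus> (g1 \<otimes> a1)" "a2 \<otimes> g1 = \<ominus> (g1 \<otimes> a2)"
  "a1 \<otimes> g2 = g2 \<otimes> a1" "a2 \<otimes> g2 = \<ominus> (g2 \<otimes> a2)"
  by (simp_all add: g1_g2 g1_a1 g1_a2 g2_a1 g2_a2)

lemma reorder_left:
  "w \<in> carrier B \<Longrightarrow> g2 \<otimes> (g1 \<otimes> w) = g1 \<otimes> (g2 \<otimes> w)"
  "w \<in> carrier B \<Longrightarrow> a1 \<otimes> (g1 \<otimes> w) = \<ominus> (g1 \<otimes> (a1 \<otimes> w))"
  "w \<in> carrier B \<Longrightarrow> a2 \<otimes> (g1 \<otimes> w) = \<ominus> (g1 \<otimes> (a2 \<otimes> w))"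
  "w \<in> carrier B \<Longrightarrow> a1 \<otimes> (g2 \<otimes> w) = g2 \<otimes> (a1 \<otimes> w)"
  "w \<in> carrier B \<Longrightarrow> a2 \<otimes> (g2 \<otimes> w) = \<ominus> (g2 \<otimes> (a2 \<otimes> w))"
  by (simp_all add: m_assoc[symmetric] reorder l_minus)

lemmas reorder_simps = reorder reorder_left m_assoc l_minus r_minus

text \<open>The inner square is a polynomial in g2^2, and g2 commutes with a1; so a2^2 can be moved
  to the front, leaving a2^2 a1^2.\<close>

lemma a1_a2_a2_a1:
  "a1 \<otimes> (a2 \<otimes> (a2 \<otimes> a1)) = (l1 * l2) \<odot> ((\<one> \<ominus> g2 \<otimes> g2) \<otimes> (\<one> \<ominus> g1 \<otimes> g1))"
proof -
  have "a1 \<otimes> (a2 \<otimes> (a2 \<otimes> a1)) = a1 \<otimes> (a2 \<otimes> a2) \<otimes> a1"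
    by (simp add: m_assoc)
  also have "a1 \<otimes> (a2 \<otimes> a2) = l2 \<odot> ((\<one> \<ominus> g2 \<otimes> g2) \<otimes> a1)"
    by (simp add: a2_a2 smult_mult_right a_minus_def l_distr r_distr reorder_simps)
  also have "l2 \<odot> ((\<one> \<ominus> g2 \<otimes> g2) \<otimes> a1) \<otimes> a1 = l2 \<odot> ((\<one> \<ominus> g2 \<otimes> g2) \<otimes> (a1 \<otimes> a1))"
    by (simp add: smult_mult_left m_assoc)
  finally show ?thesis
    by (simp add: a1_a1 smult_mult_right smult_smult mult.commute)
qed

text \<open>The element a1^2 is a polynomial in g1^2, and g1^2 commutes with a2 because two signs
  cancel; again a2^2 a1^2 remains.\<close>

lemma a2_a1_a1_a2:
  "a2 \<otimes> (a1 \<otimes> (a1 \<otimes> a2)) = (l1 * l2) \<odot> ((\<one> \<ominus> g2 \<otimes> g2) \<otimes> (\<one> \<ominus> g1 \<otimes> g1))"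
proof -
  have "a2 \<otimes> (a1 \<otimes> (a1 \<otimes> a2)) = a2 \<otimes> ((a1 \<otimes> a1) \<otimes> a2)"
    by (simp add: m_assoc)
  also have "(a1 \<otimes> a1) \<otimes> a2 = l1 \<odot> (a2 \<otimes> (\<one> \<ominus> g1 \<otimes> g1))"
    by (simp add: a1_a1 smult_mult_left a_minus_def l_distr r_distr reorder_simps)
  also have "a2 \<otimes> (l1 \<odot> (a2 \<otimes> (\<one> \<ominus> g1 \<otimes> g1))) = l1 \<odot> ((a2 \<otimes> a2) \<otimes> (\<one> \<ominus> g1 \<otimes> g1))"
    by (simp add: smult_mult_right m_assoc)
  finally show ?thesis
    by (simp add: a2_a2 smult_mult_left smult_smult)
qed

abbreviation "comm_plus \<equiv> a1 \<otimes> a2 \<oplus> a2 \<otimes> a1"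
abbreviation "comm_minus \<equiv> a1 \<otimes> a2 \<ominus> a2 \<otimes> a1"
abbreviation "alternating \<equiv> a1 \<otimes> a2 \<otimes> a1 \<otimes> a2 \<oplus> a2 \<otimes> a1 \<otimes> a2 \<otimes> a1"

text \<open>Besides the alternating words the expansion contains a1 a2^2 a1 and a2 a1^2 a2. They are
  equal, which produces the factor 2; in \<open>comm_minus_square\<close> they enter with the
  opposite sign.\<close>

lemma comm_plus_square:
  "comm_plus \<otimes> comm_plus =
    alternating \<oplus> (2 * l1 * l2) \<odot> ((\<one> \<ominus> g2 \<otimes> g2) \<otimes> (\<one> \<ominus> g1 \<otimes> g1))"
proof -
  let ?q = "(l1 * l2) \<odot> ((\<one> \<ominus> g2 \<otimes> g2) \<otimes> (\<one> \<ominus> g1 \<otimes> g1))"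
  have "comm_plus \<otimes> comm_plus = alternating \<oplus> (a1 \<otimes> (a2 \<otimes> (a2 \<otimes> a1)) \<oplus> a2 \<otimes> (a1 \<otimes> (a1 \<otimes> a2)))"
    by (simp add: l_distr r_distr m_assoc a_ac)
  also have "\<dots> = alternating \<oplus> (?q \<oplus> ?q)"
    unfolding a1_a2_a2_a1 a2_a1_a1_a2 ..
  also have "?q \<oplus> ?q = (2 * l1 * l2) \<odot> ((\<one> \<ominus> g2 \<otimes> g2) \<otimes> (\<one> \<ominus> g1 \<otimes> g1))"
    by (simp add: add_smult[symmetric] mult.assoc)
  finally show ?thesis .
qed

lemma comm_minus_square:
  "comm_minus \<otimes> comm_minus =
    alternating \<ominus> (2 * l1 * l2) \<odot> ((\<one> \<ominus> g2 \<otimes> g2) \<otimes> (\<one> \<ominus> g1 \<otimes> g1))"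
proof -
  let ?q = "(l1 * l2) \<odot> ((\<one> \<ominus> g2 \<otimes> g2) \<otimes> (\<one> \<ominus> g1 \<otimes> g1))"
  have "comm_minus \<otimes> comm_minus = alternating \<ominus> (a1 \<otimes> (a2 \<otimes> (a2 \<otimes> a1)) \<oplus> a2 \<otimes> (a1 \<otimes> (a1 \<otimes> a2)))"
    by (simp add: l_distr r_distr m_assoc a_ac a_minus_def l_minus r_minus minus_add)
  also have "\<dots> = alternating \<ominus> (?q \<oplus> ?q)"
    unfolding a1_a2_a2_a1 a2_a1_a1_a2 ..
  also have "?q \<oplus> ?q = (2 * l1 * l2) \<odot> ((\<one> \<ominus> g2 \<otimes> g2) \<otimes> (\<one> \<ominus> g1 \<otimes> g1))"
    by (simp add: add_smult[symmetric] mult.assoc)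
  finally show ?thesis .
qed

text \<open>
  In terms of the anticommutator \<open>a\<^sub>1 a\<^sub>2 + a\<^sub>2 a\<^sub>1\<close> the last relation loses its cross term; this is
  the form in which it is compatible with the comultiplication.
\<close>

lemma last_relation_iff:
  "alternating = l3 \<odot> (\<one> \<ominus> (g1 \<otimes> g1) \<otimes> (g2 \<otimes> g2)) \<ominus>
      (2 * l1 * l2) \<odot> ((\<one> \<oplus> g2 \<otimes> g2) \<otimes> (\<one> \<ominus> g1 \<otimes> g1)) \<longleftrightarrow>
   comm_plus \<otimes> comm_plus = l3 \<odot> (\<one> \<ominus> (g1 \<otimes> g1) \<otimes> (g2 \<otimes> g2)) \<ominus>
      (4 * l1 * l2) \<odot> ((g2 \<otimes> g2) \<otimes> (\<one> \<ominus> g1 \<otimes> g1))" (is "_ = ?X \<ominus> ?t \<odot> ?P \<longleftrightarrow> _ = _ \<ominus> ?s \<odot> ?R")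
proof -
  let ?Q = "(\<one> \<ominus> g2 \<otimes> g2) \<otimes> (\<one> \<ominus> g1 \<otimes> g1)"
  \<comment> \<open>Writing \<open>?P\<close> and \<open>?Q\<close> as the sum and the difference of
    1 - g1^2 and \<open>?R\<close> gives \<open>?P\<close> - \<open>?Q\<close> = 2
    \<open>?R\<close>; this doubling turns the coefficient 2 into 4.\<close>
  have P: "?P = (\<one> \<ominus> g1 \<otimes> g1) \<oplus> ?R" and Q: "?Q = (\<one> \<ominus> g1 \<otimes> g1) \<ominus> ?R"
    by (simp_all add: a_minus_def l_distr l_minus)
  have "?s \<odot> ?R = ?t \<odot> (?R \<oplus> ?R)"
    by (simp add: smult_add add_smult[symmetric] algebra_simps)
  also have "?R \<oplus> ?R = ?P \<ominus> ?Q"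
    unfolding P Q by (simp add: a_minus_def minus_add a_ac r_neg1 r_neg2)
  finally have s: "?s \<odot> ?R = ?t \<odot> ?P \<ominus> ?t \<odot> ?Q"
    by (simp add: smult_minus)
  have "comm_plus \<otimes> comm_plus = ?X \<ominus> ?s \<odot> ?R \<longleftrightarrow>
      alternating \<oplus> ?t \<odot> ?Q = ?X \<ominus> ?t \<odot> ?P \<oplus> ?t \<odot> ?Q"
    unfolding comm_plus_square s by (simp add: a_minus_def minus_add a_ac)
  also have "\<dots> \<longleftrightarrow> alternating = ?X \<ominus> ?t \<odot> ?P"
    by (rule add.right_cancel) simp_all
  finally show ?thesis by simp
qed

end

section \<open>Compatibility of the comultiplication with the relations\<close>

context H_quadruple
begin

interpretation BB: tensor_product B B by unfold_locales

abbreviation T where "T \<equiv> tensor B B"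
abbreviation pure (infix \<open>\<star>\<close> 75) where "x \<star> y \<equiv> pure_tensor B B x y"
abbreviation "d1 \<equiv> (a1 \<star> \<one>) \<oplus>\<^bsub>T\<^esub> (g1 \<star> a1)"
abbreviation "d2 \<equiv> (a2 \<star> \<one>) \<oplus>\<^bsub>T\<^esub> (g2 \<star> a2)"

text \<open>The terms k \<otimes> 1 cancel. For group-like k this expresses that 1 - k is
  skew-primitive, like the generators a_i.\<close>

lemma skew_primitive_sum:
  "k \<in> carrier B \<Longrightarrow> ((\<one> \<ominus> k) \<star> \<one>) \<oplus>\<^bsub>T\<^esub> (k \<star> (\<one> \<ominus> k)) = \<one>\<^bsub>T\<^esub> \<ominus>\<^bsub>T\<^esub> (k \<star> k)"
  by (simp add: BB.pure_minus BB.tensor_one BB.T.telescope)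

text \<open>The summands of \<open>d1\<close> anticommute because a1 and g1 do, so d1^2 = a1^2
  \<otimes> 1 + g1^2 \<otimes> a1^2, to which \<open>skew_primitive_sum\<close> applies with k =
  g1^2; \<open>d2\<close> is treated in the same way.\<close>

lemma tensor_skew: "skew_quadruple T l1 l2 (g1 \<star> g1) (g2 \<star> g2) d1 d2"
proof (unfold_locales)
  show "d1 \<otimes>\<^bsub>T\<^esub> d1 = l1 \<odot>\<^bsub>T\<^esub> (\<one>\<^bsub>T\<^esub> \<ominus>\<^bsub>T\<^esub> (g1 \<star> g1) \<otimes>\<^bsub>T\<^esub> (g1 \<star> g1))"
    by (subst BB.T.anticommute_square)
      (simp_all add: BB.pure_mult reorder BB.pure_uminus a1_a1 BB.pure_smult
        BB.T.smult_add[symmetric] skew_primitive_sum)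
  show "d2 \<otimes>\<^bsub>T\<^esub> d2 = l2 \<odot>\<^bsub>T\<^esub> (\<one>\<^bsub>T\<^esub> \<ominus>\<^bsub>T\<^esub> (g2 \<star> g2) \<otimes>\<^bsub>T\<^esub> (g2 \<star> g2))"
    by (subst BB.T.anticommute_square)
      (simp_all add: BB.pure_mult reorder BB.pure_uminus a2_a2 BB.pure_smult
        BB.T.smult_add[symmetric] skew_primitive_sum)
qed (simp_all add: BB.T.l_distr BB.T.r_distr BB.pure_mult reorder BB.pure_uminus BB.T.minus_add)

interpretation T: skew_quadruple T l1 l2 "g1 \<star> g1" "g2 \<star> g2" d1 d2
  by (rule tensor_skew)

text \<open>Of the mixed terms, those with a2 on the right agree since g2 commutes with a1, hence
  the coefficient 2; those with a1 on the right cancel since g1 anticommutes with a2.\<close>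

lemma T_comm_plus:
  "T.comm_plus = (comm_plus \<star> \<one>) \<oplus>\<^bsub>T\<^esub> (2 \<odot>\<^bsub>T\<^esub> ((g2 \<otimes> a1) \<star> a2)) \<oplus>\<^bsub>T\<^esub> ((g1 \<otimes> g2) \<star> comm_plus)"
proof -
  have two: "2 \<odot>\<^bsub>T\<^esub> x = x \<oplus>\<^bsub>T\<^esub> x" if "x \<in> carrier T" for x
    using BB.T.add_smult[of x 1 1] that by simp
  \<comment> \<open>The cancelling mixed term is kept on the right-hand side, so that both sides
    have the same summands and agree up to rearrangement.\<close>
  let ?r = "(g1 \<otimes> a2) \<star> a1"
  have "T.comm_plus = ((comm_plus \<star> \<one>) \<oplus>\<^bsub>T\<^esub> (2 \<odot>\<^bsub>T\<^esub> ((g2 \<otimes> a1) \<star> a2)) \<oplus>\<^bsub>T\<^esub> ((g1 \<otimes> g2) \<star> comm_plus))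
      \<oplus>\<^bsub>T\<^esub> (?r \<oplus>\<^bsub>T\<^esub> \<ominus>\<^bsub>T\<^esub> ?r)"
    by (simp add: two BB.T.l_distr BB.T.r_distr BB.pure_mult reorder BB.pure_uminus BB.pure_add
        BB.T.a_ac)
  then show ?thesis
    by (simp add: BB.T.r_neg)
qed

lemma comm_plus_square_eq:
  "comm_plus \<otimes> comm_plus = l3 \<odot> (\<one> \<ominus> (g1 \<otimes> g1) \<otimes> (g2 \<otimes> g2)) \<ominus>
      (4 * l1 * l2) \<odot> ((g2 \<otimes> g2) \<otimes> (\<one> \<ominus> g1 \<otimes> g1))"
  using last_relation last_relation_iff by blast

lemma T_comm_plus_square:
  "T.comm_plus \<otimes>\<^bsub>T\<^esub> T.comm_plus = ((comm_plus \<otimes> comm_plus) \<star> \<one>)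
    \<oplus>\<^bsub>T\<^esub> 4 \<odot>\<^bsub>T\<^esub> (((g2 \<otimes> g2) \<otimes> (a1 \<otimes> a1)) \<star> (a2 \<otimes> a2))
    \<oplus>\<^bsub>T\<^esub> (((g1 \<otimes> g1) \<otimes> (g2 \<otimes> g2)) \<star> (comm_plus \<otimes> comm_plus))"
proof -
  define c where "c = comm_plus"
  have [simp]: "c \<in> carrier B"
    by (simp add: c_def)
  \<comment> \<open>The squares commute with the other generator; by this, multiplying c by a1 or a2
    from the left or from the right gives the same sum of words.\<close>
  have "a1 \<otimes> a1 \<otimes> a2 = a2 \<otimes> (a1 \<otimes> a1)" "a2 \<otimes> a2 \<otimes> a1 = a1 \<otimes> (a2 \<otimes> a2)"
    by (simp_all add: a1_a1 a2_a2 smult_mult_left smult_mult_right a_minus_def l_distr r_distr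
        reorder_simps)
  then have ac: "a1 \<otimes> c = c \<otimes> a1" "a2 \<otimes> c = c \<otimes> a2"
    by (simp_all add: c_def l_distr r_distr m_assoc a_comm)
  \<comment> \<open>Each word of c contains two letters anticommuting with g1 but only one
    anticommuting with g2.\<close>
  have cg: "c \<otimes> g1 = g1 \<otimes> c" "c \<otimes> g2 = \<ominus> (g2 \<otimes> c)"
    by (simp_all add: c_def l_distr r_distr reorder_simps minus_add)
  have cg_left: "c \<otimes> (g1 \<otimes> w) = g1 \<otimes> (c \<otimes> w)" "c \<otimes> (g2 \<otimes> w) = \<ominus> (g2 \<otimes> (c \<otimes> w))"
      "a1 \<otimes> (c \<otimes> w) = c \<otimes> (a1 \<otimes> w)" "a2 \<otimes> (c \<otimes> w) = c \<otimes> (a2 \<otimes> w)" if "w \<in> carrier B" for w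
    using that by (simp_all add: m_assoc[symmetric] ac cg l_minus)
  note rules = reorder_simps ac cg cg_left BB.pure_mult BB.pure_uminus BB.T.smult_mult_left
    BB.T.smult_mult_right BB.T.smult_uminus BB.T.smult_smult
  let ?U = "c \<star> \<one>" and ?P = "2 \<odot>\<^bsub>T\<^esub> ((g2 \<otimes> a1) \<star> a2)" and ?V = "(g1 \<otimes> g2) \<star> c"
  have "(?U \<oplus>\<^bsub>T\<^esub> ?P \<oplus>\<^bsub>T\<^esub> ?V) \<otimes>\<^bsub>T\<^esub> (?U \<oplus>\<^bsub>T\<^esub> ?P \<oplus>\<^bsub>T\<^esub> ?V) =
      ?U \<otimes>\<^bsub>T\<^esub> ?U \<oplus>\<^bsub>T\<^esub> ?P \<otimes>\<^bsub>T\<^esub> ?P \<oplus>\<^bsub>T\<^esub> ?V \<otimes>\<^bsub>T\<^esub> ?V"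
    by (rule BB.T.anticommute_square3) (simp_all add: rules)
  then show ?thesis
    unfolding T_comm_plus c_def[symmetric] by (simp add: rules)
qed

lemma tensor_quadruple: "H_quadruple T l1 l2 (g1 \<star> g1) (g2 \<star> g2) d1 d2 l3 N M"
proof -
  let ?Q = "\<one> \<ominus> g1 \<otimes> g1" and ?G = "(g1 \<otimes> g1) \<otimes> (g2 \<otimes> g2)" and ?k = "4 * l1 * l2"
  let ?R = "(g2 \<otimes> g2) \<otimes> ?Q"
  have "T.comm_plus \<otimes>\<^bsub>T\<^esub> T.comm_plus =
      (l3 \<odot>\<^bsub>T\<^esub> ((\<one> \<ominus> ?G) \<star> \<one>) \<ominus>\<^bsub>T\<^esub> ?k \<odot>\<^bsub>T\<^esub> (?R \<star> \<one>))
      \<oplus>\<^bsub>T\<^esub> (?k \<odot>\<^bsub>T\<^esub> (?R \<star> \<one>) \<ominus>\<^bsub>T\<^esub> ?k \<odot>\<^bsub>T\<^esub> (?R \<star> (g2 \<otimes> g2)))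
      \<oplus>\<^bsub>T\<^esub> (l3 \<odot>\<^bsub>T\<^esub> (?G \<star> (\<one> \<ominus> ?G)) \<ominus>\<^bsub>T\<^esub> ?k \<odot>\<^bsub>T\<^esub> (?G \<star> ?R))"
    unfolding T_comm_plus_square comm_plus_square_eq a1_a1 a2_a2
    by (simp add: BB.pure_minus BB.pure_smult smult_mult_right BB.T.smult_smult BB.T.smult_minus
        mult_ac)
  also have "\<dots> = l3 \<odot>\<^bsub>T\<^esub> (((\<one> \<ominus> ?G) \<star> \<one>) \<oplus>\<^bsub>T\<^esub> (?G \<star> (\<one> \<ominus> ?G)))
      \<ominus>\<^bsub>T\<^esub> ?k \<odot>\<^bsub>T\<^esub> ((?R \<star> (g2 \<otimes> g2)) \<oplus>\<^bsub>T\<^esub> (?G \<star> ?R))"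
    \<comment> \<open>Here the term \<open>?k\<close> (\<open>?R\<close> \<otimes> 1) cancels
      between the first summand and the square of the middle one.\<close>
    by (subst BB.T.telescope)
      (simp_all add: BB.T.smult_add a_minus_def[of T] BB.T.minus_add BB.T.a_ac)
  \<comment> \<open>Factoring out g2^2 \<otimes> g2^2 leaves the skew-primitive expression for k =
    g1^2.\<close>
  also have "(?R \<star> (g2 \<otimes> g2)) \<oplus>\<^bsub>T\<^esub> (?G \<star> ?R) =
      ((g2 \<otimes> g2) \<star> (g2 \<otimes> g2)) \<otimes>\<^bsub>T\<^esub> ((?Q \<star> \<one>) \<oplus>\<^bsub>T\<^esub> ((g1 \<otimes> g1) \<star> ?Q))"
    by (simp add: BB.T.r_distr BB.pure_mult reorder_simps)
  also have "\<dots> = ((g2 \<otimes> g2) \<star> (g2 \<otimes> g2)) \<otimes>\<^bsub>T\<^esub> (\<one>\<^bsub>T\<^esub> \<ominus>\<^bsub>T\<^esub> ((g1 \<otimes> g1) \<star> (g1 \<otimes> g1)))"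
    by (simp add: skew_primitive_sum)
  finally have "T.comm_plus \<otimes>\<^bsub>T\<^esub> T.comm_plus =
      l3 \<odot>\<^bsub>T\<^esub> (\<one>\<^bsub>T\<^esub> \<ominus>\<^bsub>T\<^esub> ((g1 \<star> g1) \<otimes>\<^bsub>T\<^esub> (g1 \<star> g1)) \<otimes>\<^bsub>T\<^esub> ((g2 \<star> g2) \<otimes>\<^bsub>T\<^esub> (g2 \<star> g2)))
      \<ominus>\<^bsub>T\<^esub> ?k \<odot>\<^bsub>T\<^esub> (((g2 \<star> g2) \<otimes>\<^bsub>T\<^esub> (g2 \<star> g2)) \<otimes>\<^bsub>T\<^esub> (\<one>\<^bsub>T\<^esub> \<ominus>\<^bsub>T\<^esub> (g1 \<star> g1) \<otimes>\<^bsub>T\<^esub> (g1 \<star> g1)))"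
    by (simp add: skew_primitive_sum BB.pure_mult)
  then show ?thesis
    unfolding T.last_relation_iff[symmetric]
    by (intro H_quadruple.intro tensor_skew H_quadruple_axioms.intro)
      (simp_all add: BB.pure_nat_pow g1_order g2_order BB.tensor_one)
qed

end

section \<open>The opposite algebra and the ground field as targets\<close>

lemma a_inv_opposite_algebra: "a_inv (opposite_algebra A) = a_inv A"
  by (simp add: a_inv_def opposite_algebra_def)

lemma opposite_algebra_simps [simp]:
  "carrier (opposite_algebra A) = carrier A" "\<one>\<^bsub>opposite_algebra A\<^esub> = \<one>\<^bsub>A\<^esub>"
  "x \<otimes>\<^bsub>opposite_algebra A\<^esub> y = y \<otimes>\<^bsub>A\<^esub> x" "x \<oplus>\<^bsub>opposite_algebra A\<^esub> y = x \<oplus>\<^bsub>A\<^esub> y"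
  "c \<odot>\<^bsub>opposite_algebra A\<^esub> x = c \<odot>\<^bsub>A\<^esub> x" "\<ominus>\<^bsub>opposite_algebra A\<^esub> x = \<ominus>\<^bsub>A\<^esub> x"
  "x \<ominus>\<^bsub>opposite_algebra A\<^esub> y = x \<ominus>\<^bsub>A\<^esub> y"
  by (simp_all add: a_minus_def a_inv_opposite_algebra, simp_all add: opposite_algebra_def)

lemma (in assoc_algebra) opposite_algebra_nat_pow:
  assumes "x \<in> carrier A"
  shows "x [^]\<^bsub>opposite_algebra A\<^esub> (n :: nat) = x [^] n"
proof -
  interpret op: assoc_algebra "opposite_algebra A"
    by (rule opposite_algebra_assoc_algebra[OF assoc_algebra_axioms])
  show ?thesis
  proof (induction n)
    case 0
    show ?case using op.nat_pow_0[of x] by simp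
  next
    case (Suc n)
    then show ?case
      using op.nat_pow_Suc[of x n] nat_pow_Suc2[OF assms, of n] by simp
  qed
qed

lemma base_algebra_quadruple:
  "H_quadruple (base_algebra :: ('k::field, 'k) module) l1 l2 1 1 0 0 l3 N M"
proof -
  interpret assoc_algebra "base_algebra :: ('k, 'k) module"
    by (rule base_algebra_assoc_algebra)
  have [simp]: "\<ominus>\<^bsub>base_algebra\<^esub> x = - x" for x :: 'k
    by (rule minus_equality) (simp_all add: base_algebra_def)
  have pow: "(1 :: 'k) [^]\<^bsub>base_algebra\<^esub> (n :: nat) = 1" for n
    using nat_pow_one[of n] by (simp add: base_algebra_def)
  show ?thesis
    by unfold_locales (simp_all add: a_minus_def pow, simp_all add: base_algebra_def)
qed

section \<open>Invertible elements of a monoid\<close>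

context monoid
begin

lemma order_Unit:
  assumes "x \<in> carrier G" "x [^] (n :: nat) = \<one>" "n > 0"
  shows "x \<in> Units G"
proof -
  \<comment> \<open>The inverse is the power with exponent m = n - 1; positivity of n is what
    provides it.\<close>
  obtain m where n: "n = Suc m"
    using assms(3) by (cases n) auto
  have "x [^] m \<otimes> x = \<one>" "x \<otimes> x [^] m = \<one>"
    using assms(1,2) nat_pow_Suc2[of x m] unfolding n by simp_all
  then show ?thesis
    using assms(1) unfolding Units_def by blast
qed

lemma inv_order:
  assumes "x \<in> Units G" "x [^] (n :: nat) = \<one>"
  shows "inv x [^] n = \<one>"
proof -
  have "inv x [^] n = inv x [^] n \<otimes> x [^] n"
    using assms by (simp add: Units_closed)
  also have "\<dots> = (inv x \<otimes> x) [^] n"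
    using assms(1) by (intro pow_mult_distrib[symmetric]) (simp_all add: Units_closed)
  finally show ?thesis
    using assms(1) by simp
qed

text \<open>Turns a commutation rule for x into one for its inverse. With z = y or z = -y it
  transfers the sign rules of g1 and g2 to their inverses.\<close>

lemma inv_commute:
  assumes "x \<in> Units G" "y \<in> carrier G" "z \<in> carrier G" "x \<otimes> y = z \<otimes> x"
  shows "y \<otimes> inv x = inv x \<otimes> z"
proof -
  have "y \<otimes> inv x = inv x \<otimes> (x \<otimes> y) \<otimes> inv x"
    using assms(1,2) by (simp add: m_assoc[symmetric] Units_closed)
  also have "\<dots> = inv x \<otimes> z"
    using assms by (simp add: m_assoc Units_closed)
  finally show ?thesis .
qed

end

section \<open>Compatibility of the antipode with the relations\<close>

context H_quadruple
begin

context
  assumes positive: "N > 0" "M > 0"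
begin

lemma Units: "g1 \<in> Units B" "g2 \<in> Units B"
  using order_Unit[of g1 "2 * N"] order_Unit[of g2 "2 * M"] g1_order g2_order positive by simp_all

abbreviation (input) "k1 \<equiv> inv g1"
abbreviation (input) "k2 \<equiv> inv g2"

lemma inv_closed [simp]: "k1 \<in> carrier B" "k2 \<in> carrier B"
  using Units by simp_all

lemma inv_cancel:
  "k1 \<otimes> g1 = \<one>" "g1 \<otimes> k1 = \<one>" "k2 \<otimes> g2 = \<one>" "g2 \<otimes> k2 = \<one>"
  "w \<in> carrier B \<Longrightarrow> k1 \<otimes> (g1 \<otimes> w) = w" "w \<in> carrier B \<Longrightarrow> g1 \<otimes> (k1 \<otimes> w) = w"
  "w \<in> carrier B \<Longrightarrow> k2 \<otimes> (g2 \<otimes> w) = w" "w \<in> carrier B \<Longrightarrow> g2 \<otimes> (k2 \<otimes> w) = w"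
  using Units by (simp_all add: m_assoc[symmetric])

lemma inv_reorder:
  "k2 \<otimes> k1 = k1 \<otimes> k2" "k2 \<otimes> g1 = g1 \<otimes> k2" "g2 \<otimes> k1 = k1 \<otimes> g2"
  "a1 \<otimes> k1 = \<ominus> (k1 \<otimes> a1)" "a2 \<otimes> k1 = \<ominus> (k1 \<otimes> a2)"
  "a1 \<otimes> k2 = k2 \<otimes> a1" "a2 \<otimes> k2 = \<ominus> (k2 \<otimes> a2)"
proof -
  show g2k1: "g2 \<otimes> k1 = k1 \<otimes> g2"
    using inv_commute[of g1 g2 g2] Units by (simp add: g1_g2)
  show "k2 \<otimes> g1 = g1 \<otimes> k2"
    using inv_commute[of g2 g1 g1] Units by (simp add: g1_g2)
  show "k2 \<otimes> k1 = k1 \<otimes> k2"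
    using inv_commute[of g2 k1 k1] Units by (simp add: g2k1)
  show "a1 \<otimes> k1 = \<ominus> (k1 \<otimes> a1)" "a2 \<otimes> k1 = \<ominus> (k1 \<otimes> a2)"
    using inv_commute[of g1 a1 "\<ominus> a1"] inv_commute[of g1 a2 "\<ominus> a2"] Units
    by (simp_all add: g1_a1 g1_a2 l_minus r_minus)
  show "a1 \<otimes> k2 = k2 \<otimes> a1" "a2 \<otimes> k2 = \<ominus> (k2 \<otimes> a2)"
    using inv_commute[of g2 a1 "a1"] inv_commute[of g2 a2 "\<ominus> a2"] Units
    by (simp_all add: g2_a1 g2_a2 l_minus r_minus)
qed

lemma inv_reorder_left:
  "w \<in> carrier B \<Longrightarrow> k2 \<otimes> (k1 \<otimes> w) = k1 \<otimes> (k2 \<otimes> w)"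
  "w \<in> carrier B \<Longrightarrow> k2 \<otimes> (g1 \<otimes> w) = g1 \<otimes> (k2 \<otimes> w)"
  "w \<in> carrier B \<Longrightarrow> g2 \<otimes> (k1 \<otimes> w) = k1 \<otimes> (g2 \<otimes> w)"
  "w \<in> carrier B \<Longrightarrow> a1 \<otimes> (k1 \<otimes> w) = \<ominus> (k1 \<otimes> (a1 \<otimes> w))"
  "w \<in> carrier B \<Longrightarrow> a2 \<otimes> (k1 \<otimes> w) = \<ominus> (k1 \<otimes> (a2 \<otimes> w))"
  "w \<in> carrier B \<Longrightarrow> a1 \<otimes> (k2 \<otimes> w) = k2 \<otimes> (a1 \<otimes> w)"
  "w \<in> carrier B \<Longrightarrow> a2 \<otimes> (k2 \<otimes> w) = \<ominus> (k2 \<otimes> (a2 \<otimes> w))"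
  by (simp_all add: m_assoc[symmetric] inv_reorder l_minus)

lemmas inv_simps = inv_reorder inv_reorder_left inv_cancel m_assoc l_minus r_minus

abbreviation (input) "b1 \<equiv> \<ominus> (k1 \<otimes> a1)"
abbreviation (input) "b2 \<equiv> \<ominus> (k2 \<otimes> a2)"

text \<open>Moving k1 past a1 yields b1^2 = -k1^2 a1^2 = -l1 (k1^2 - 1), so the sign from
  anticommuting is compensated by inverting g1; likewise for b2.\<close>

lemma opposite_skew: "skew_quadruple (opposite_algebra B) l1 l2 k1 k2 b1 b2"
proof (intro skew_quadruple.intro skew_quadruple_axioms.intro opposite_algebra_assoc_algebra
    assoc_algebra_axioms)
  have "b1 \<otimes> b1 = \<ominus> ((k1 \<otimes> k1) \<otimes> (a1 \<otimes> a1))"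
    by (simp add: inv_simps)
  also have "\<dots> = l1 \<odot> (\<one> \<ominus> k1 \<otimes> k1)"
    by (simp add: a1_a1 smult_mult_right a_minus_def r_distr inv_simps smult_uminus[symmetric] minus_add a_comm)
  finally show "b1 \<otimes>\<^bsub>opposite_algebra B\<^esub> b1 =
      l1 \<odot>\<^bsub>opposite_algebra B\<^esub> (\<one>\<^bsub>opposite_algebra B\<^esub> \<ominus>\<^bsub>opposite_algebra B\<^esub> k1 \<otimes>\<^bsub>opposite_algebra B\<^esub> k1)"
    by simp
  have "b2 \<otimes> b2 = \<ominus> ((k2 \<otimes> k2) \<otimes> (a2 \<otimes> a2))"
    by (simp add: inv_simps)
  also have "\<dots> = l2 \<odot> (\<one> \<ominus> k2 \<otimes> k2)"
    by (simp add: a2_a2 smult_mult_right a_minus_def r_distr inv_simps smult_uminus[symmetric] minus_add a_comm)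
  finally show "b2 \<otimes>\<^bsub>opposite_algebra B\<^esub> b2 =
      l2 \<odot>\<^bsub>opposite_algebra B\<^esub> (\<one>\<^bsub>opposite_algebra B\<^esub> \<ominus>\<^bsub>opposite_algebra B\<^esub> k2 \<otimes>\<^bsub>opposite_algebra B\<^esub> k2)"
    by simp
qed (simp_all add: inv_simps)

interpretation op: skew_quadruple "opposite_algebra B" l1 l2 k1 k2 b1 b2
  by (rule opposite_skew)

text \<open>The factors 1 + g2^2 and 1 - g2^2 add up to 2, so the dependence on g2 disappears from
  the second term and the coefficient becomes 4.\<close>

lemma comm_minus_square_eq:
  "comm_minus \<otimes> comm_minus = l3 \<odot> (\<one> \<ominus> (g1 \<otimes> g1) \<otimes> (g2 \<otimes> g2)) \<ominus>
      (4 * l1 * l2) \<odot> (\<one> \<ominus> g1 \<otimes> g1)"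
proof -
  let ?Q = "\<one> \<ominus> g1 \<otimes> g1"
  have "(\<one> \<oplus> g2 \<otimes> g2) \<otimes> ?Q \<oplus> (\<one> \<ominus> g2 \<otimes> g2) \<otimes> ?Q = (\<one> \<oplus> g2 \<otimes> g2 \<oplus> (\<one> \<ominus> g2 \<otimes> g2)) \<otimes> ?Q"
    by (simp add: l_distr)
  also have "\<one> \<oplus> g2 \<otimes> g2 \<oplus> (\<one> \<ominus> g2 \<otimes> g2) = \<one> \<oplus> \<one> \<oplus> (g2 \<otimes> g2 \<oplus> \<ominus> (g2 \<otimes> g2))"
    by (simp add: a_minus_def a_ac)
  finally have "(\<one> \<oplus> g2 \<otimes> g2) \<otimes> ?Q \<oplus> (\<one> \<ominus> g2 \<otimes> g2) \<otimes> ?Q = ?Q \<oplus> ?Q"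
    by (simp add: r_neg l_distr)
  then have "(2 * l1 * l2) \<odot> ((\<one> \<oplus> g2 \<otimes> g2) \<otimes> ?Q) \<oplus> (2 * l1 * l2) \<odot> ((\<one> \<ominus> g2 \<otimes> g2) \<otimes> ?Q) =
      (4 * l1 * l2) \<odot> ?Q"
    by (simp add: smult_add[symmetric]) (simp add: smult_add add_smult[symmetric] mult.assoc)
  then show ?thesis
    unfolding comm_minus_square last_relation
    by (simp add: a_minus_def a_assoc minus_add[symmetric])
qed

lemma opposite_quadruple: "H_quadruple (opposite_algebra B) l1 l2 k1 k2 b1 b2 l3 N M"
proof -
  define d where "d = comm_minus"
  have [simp]: "d \<in> carrier B"
    by (simp add: d_def)
  have dk: "d \<otimes> k1 = k1 \<otimes> d" "d \<otimes> k2 = \<ominus> (k2 \<otimes> d)"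
    by (simp_all add: d_def a_minus_def l_distr r_distr inv_simps minus_add)
  have dk_left: "d \<otimes> (k1 \<otimes> w) = k1 \<otimes> (d \<otimes> w)" "d \<otimes> (k2 \<otimes> w) = \<ominus> (k2 \<otimes> (d \<otimes> w))"
    if "w \<in> carrier B" for w
    using that by (simp_all add: m_assoc[symmetric] dk l_minus)
  \<comment> \<open>The plus sign turns into the minus sign of d because a2 passes k1 in one
    product, while a1 commutes with k2 in the other.\<close>
  have "op.comm_plus = (k1 \<otimes> k2) \<otimes> d"
    by (simp add: d_def a_minus_def r_distr inv_simps a_comm)
  then have "op.comm_plus \<otimes> op.comm_plus = \<ominus> ((k1 \<otimes> k1) \<otimes> (k2 \<otimes> k2) \<otimes> (d \<otimes> d))"
    by (simp add: inv_simps dk dk_left)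
  \<comment> \<open>The prefactor k1^2 k2^2 cancels against g1^2 g2^2 in the first bracket and
    against g1^2 in the second, which restores the factor k2^2 missing from the square of d.\<close>
  also have "\<dots> = \<ominus> (l3 \<odot> ((k1 \<otimes> k1) \<otimes> (k2 \<otimes> k2) \<ominus> \<one>) \<ominus>
      (4 * l1 * l2) \<odot> ((k1 \<otimes> k1) \<otimes> (k2 \<otimes> k2) \<ominus> k2 \<otimes> k2))"
    unfolding d_def comm_minus_square_eq
    by (simp add: a_minus_def r_distr inv_simps smult_mult_right reorder reorder_left)
  also have "\<dots> = l3 \<odot> (\<one> \<ominus> (k2 \<otimes> k2) \<otimes> (k1 \<otimes> k1)) \<ominus>
      (4 * l1 * l2) \<odot> ((\<one> \<ominus> k1 \<otimes> k1) \<otimes> (k2 \<otimes> k2))"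
    by (simp add: a_minus_def l_distr inv_simps smult_uminus[symmetric] minus_add a_comm)
  finally have "op.comm_plus \<otimes>\<^bsub>opposite_algebra B\<^esub> op.comm_plus =
    l3 \<odot>\<^bsub>opposite_algebra B\<^esub> (\<one>\<^bsub>opposite_algebra B\<^esub> \<ominus>\<^bsub>opposite_algebra B\<^esub>
        (k1 \<otimes>\<^bsub>opposite_algebra B\<^esub> k1) \<otimes>\<^bsub>opposite_algebra B\<^esub> (k2 \<otimes>\<^bsub>opposite_algebra B\<^esub> k2))
      \<ominus>\<^bsub>opposite_algebra B\<^esub> (4 * l1 * l2) \<odot>\<^bsub>opposite_algebra B\<^esub> ((k2 \<otimes>\<^bsub>opposite_algebra B\<^esub> k2)
        \<otimes>\<^bsub>opposite_algebra B\<^esub> (\<one>\<^bsub>opposite_algebra B\<^esub> \<ominus>\<^bsub>opposite_algebra B\<^esub> k1 \<otimes>\<^bsub>opposite_algebra B\<^esub> k1))"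
    by simp
  then show ?thesis
    unfolding op.last_relation_iff[symmetric]
    by (intro H_quadruple.intro opposite_skew H_quadruple_axioms.intro)
      (simp_all add: opposite_algebra_nat_pow inv_order Units g1_order g2_order)
qed

end

end

section \<open>The Hopf algebra structure\<close>

text \<open>\<open>H_lambda\<close> and \<open>H_alg\<close> are records of different types. Tensor
  products see only the operations listed here, so everything is proved for \<open>H_alg\<close> and
  rewritten.\<close>

lemma tensor_cong:
  assumes "carrier A' = carrier A" "monoid.mult A' = monoid.mult A" "\<one>\<^bsub>A'\<^esub> = \<one>\<^bsub>A\<^esub>"
      "add A' = add A" "module.smult A' = module.smult A"
    and "carrier B' = carrier B" "monoid.mult B' = monoid.mult B" "\<one>\<^bsub>B'\<^esub> = \<one>\<^bsub>B\<^esub>"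
      "add B' = add B" "module.smult B' = module.smult B"
  shows "tensor A' B' = tensor A B" "pure_tensor A' B' = pure_tensor A B"
proof -
  have "A' \<times>\<times> B' = A \<times>\<times> B"
    using assms by (simp add: DirProd_def)
  moreover have "bilinearity_subspace A' B' = bilinearity_subspace A B"
    using assms by (simp add: bilinearity_subspace_def bilinearity_relators_def)
  ultimately show "tensor A' B' = tensor A B" "pure_tensor A' B' = pure_tensor A B"
    by (simp_all add: tensor_def pure_tensor_def fun_eq_iff)
qed

lemma linear_maps_opposite: "linear_maps A (opposite_algebra B) = linear_maps A B"
  by (simp add: linear_maps_def)

context
  fixes N M :: nat and l1 l2 l3 :: "'k::field"
  assumes positive: "N > 0" "M > 0"
begin

private abbreviation (input) "A \<equiv> H_alg N M l1 l2 l3"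
private abbreviation (input) "H \<equiv> H_lambda N M l1 l2 l3"
private abbreviation (input) "gen \<equiv> H_gen N M l1 l2 l3"
private abbreviation (input) "g1 \<equiv> gen G1"
private abbreviation (input) "g2 \<equiv> gen G2"
private abbreviation (input) "a1 \<equiv> gen A1"
private abbreviation (input) "a2 \<equiv> gen A2"

interpretation A: H_quadruple A l1 l2 g1 g2 a1 a2 l3 N M
  by (rule H_gen_quadruple)

private abbreviation (input) "T \<equiv> tensor A A"
private abbreviation (input) pure (infix \<open>\<star>\<close> 75) where "x \<star> y \<equiv> pure_tensor A A x y"

interpretation AA: tensor_product A A by unfold_locales
interpretation AT: tensor_product A T by unfold_locales
interpretation TA: tensor_product T A by unfold_locales
interpretation AA_AT: tensor_product2 A A A T by unfold_locales
interpretation AA_TA: tensor_product2 A A T A by unfold_locales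

lemma H_simps [simp]:
  "carrier H = carrier A" "monoid.mult H = monoid.mult A" "\<one>\<^bsub>H\<^esub> = \<one>\<^bsub>A\<^esub>" "\<zero>\<^bsub>H\<^esub> = \<zero>\<^bsub>A\<^esub>"
  "add H = add A" "module.smult H = module.smult A"
  by (simp_all add: H_lambda_def Let_def)

lemma H_assoc_algebra: "assoc_algebra H"
  by (rule assoc_algebra_cong[OF A.assoc_algebra_axioms]) simp_all

lemma H_tensor [simp]:
  "tensor H H = T" "tensor H T = tensor A T" "tensor T H = tensor T A"
  "pure_tensor H H = pure_tensor A A" "pure_tensor H T = pure_tensor A T"
  "pure_tensor T H = pure_tensor T A"
  by (rule tensor_cong; simp)+

lemma H_homs [simp]:
  "algebra_homs H B = algebra_homs A B" "linear_maps H B = linear_maps A B"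
  "linear_maps B H = linear_maps B A"
  by (simp_all add: algebra_homs_def linear_maps_def ring_hom_def)

lemma H_linear_extension [simp]: "linear_extension H f p = linear_extension A f p"
  by (simp add: linear_extension_def finsum_def finprod_def)

lemma H_tensor_lift [simp]: "tensor_lift H \<beta> = tensor_lift A \<beta>"
  by (simp add: tensor_lift_def induced_map_def fun_eq_iff)

lemma H_tensor_map [simp]:
  "tensor_map H T = tensor_map A T" "tensor_map T H = tensor_map T A" "tensor_assoc H = tensor_assoc A"
  by (simp_all add: tensor_map_def tensor_assoc_def fun_eq_iff)

lemma H_inv [simp]: "inv\<^bsub>H\<^esub> x = inv\<^bsub>A\<^esub> x"
  by (simp add: m_inv_def)

lemma H_nat_pow [simp]: "x [^]\<^bsub>H\<^esub> (n :: nat) = x [^]\<^bsub>A\<^esub> n"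
  by (simp add: nat_pow_def)

lemma gen_in_carrier [simp]: "gen x \<in> carrier A"
  by (cases x) simp_all

private abbreviation (input) "\<Delta> \<equiv> comult H"
private abbreviation (input) "\<epsilon> \<equiv> counit H"
private abbreviation (input) "S \<equiv> antipode H"

section \<open>The structure maps on generators\<close>

lemma comult:
  "\<Delta> \<in> algebra_homs A T"
  "\<Delta> g1 = g1 \<star> g1" "\<Delta> g2 = g2 \<star> g2"
  "\<Delta> a1 = (a1 \<star> \<one>\<^bsub>A\<^esub>) \<oplus>\<^bsub>T\<^esub> (g1 \<star> a1)" "\<Delta> a2 = (a2 \<star> \<one>\<^bsub>A\<^esub>) \<oplus>\<^bsub>T\<^esub> (g2 \<star> a2)"
proof -
  let ?f = "\<lambda>x. case x of G1 \<Rightarrow> g1 \<star> g1 | G2 \<Rightarrow> g2 \<star> g2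
    | A1 \<Rightarrow> (a1 \<star> \<one>\<^bsub>A\<^esub>) \<oplus>\<^bsub>T\<^esub> (g1 \<star> a1) | A2 \<Rightarrow> (a2 \<star> \<one>\<^bsub>A\<^esub>) \<oplus>\<^bsub>T\<^esub> (g2 \<star> a2)"
  have f: "H_quadruple T l1 l2 (?f G1) (?f G2) (?f A1) (?f A2) l3 N M"
    using A.tensor_quadruple by simp
  have D: "\<Delta> = induced_map (free_lift T ?f)"
    by (simp add: H_lambda_def Let_def)
  show "\<Delta> \<in> algebra_homs A T"
    unfolding D by (rule H_lift_algebra_hom[OF f])
  show "\<Delta> g1 = g1 \<star> g1" "\<Delta> g2 = g2 \<star> g2"
    "\<Delta> a1 = (a1 \<star> \<one>\<^bsub>A\<^esub>) \<oplus>\<^bsub>T\<^esub> (g1 \<star> a1)" "\<Delta> a2 = (a2 \<star> \<one>\<^bsub>A\<^esub>) \<oplus>\<^bsub>T\<^esub> (g2 \<star> a2)"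
    unfolding D by (simp_all add: H_lift_gen[OF f])
qed

lemma counit:
  "\<epsilon> \<in> algebra_homs A base_algebra" "\<epsilon> g1 = 1" "\<epsilon> g2 = 1" "\<epsilon> a1 = 0" "\<epsilon> a2 = 0"
proof -
  let ?f = "\<lambda>x. case x of G1 \<Rightarrow> (1 :: 'k) | G2 \<Rightarrow> 1 | A1 \<Rightarrow> 0 | A2 \<Rightarrow> 0"
  have f: "H_quadruple base_algebra l1 l2 (?f G1) (?f G2) (?f A1) (?f A2) l3 N M"
    using base_algebra_quadruple by simp
  have D: "\<epsilon> = induced_map (free_lift base_algebra ?f)"
    by (simp add: H_lambda_def Let_def)
  show "\<epsilon> \<in> algebra_homs A base_algebra"
    unfolding D by (rule H_lift_algebra_hom[OF f])
  show "\<epsilon> g1 = 1" "\<epsilon> g2 = 1" "\<epsilon> a1 = 0" "\<epsilon> a2 = 0"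
    unfolding D by (simp_all add: H_lift_gen[OF f])
qed

lemma antipode:
  "S \<in> algebra_homs A (opposite_algebra A)"
  "S g1 = inv\<^bsub>A\<^esub> g1" "S g2 = inv\<^bsub>A\<^esub> g2"
  "S a1 = \<ominus>\<^bsub>A\<^esub> (inv\<^bsub>A\<^esub> g1 \<otimes>\<^bsub>A\<^esub> a1)" "S a2 = \<ominus>\<^bsub>A\<^esub> (inv\<^bsub>A\<^esub> g2 \<otimes>\<^bsub>A\<^esub> a2)"
proof -
  let ?f = "\<lambda>x. case x of G1 \<Rightarrow> inv\<^bsub>A\<^esub> g1 | G2 \<Rightarrow> inv\<^bsub>A\<^esub> g2
    | A1 \<Rightarrow> \<ominus>\<^bsub>A\<^esub> (inv\<^bsub>A\<^esub> g1 \<otimes>\<^bsub>A\<^esub> a1) | A2 \<Rightarrow> \<ominus>\<^bsub>A\<^esub> (inv\<^bsub>A\<^esub> g2 \<otimes>\<^bsub>A\<^esub> a2)"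
  have f: "H_quadruple (opposite_algebra A) l1 l2 (?f G1) (?f G2) (?f A1) (?f A2) l3 N M"
    using A.opposite_quadruple[OF positive] by simp
  have D: "S = induced_map (free_lift (opposite_algebra A) ?f)"
    by (simp add: H_lambda_def Let_def)
  show "S \<in> algebra_homs A (opposite_algebra A)"
    unfolding D by (rule H_lift_algebra_hom[OF f])
  show "S g1 = inv\<^bsub>A\<^esub> g1" "S g2 = inv\<^bsub>A\<^esub> g2"
    "S a1 = \<ominus>\<^bsub>A\<^esub> (inv\<^bsub>A\<^esub> g1 \<otimes>\<^bsub>A\<^esub> a1)" "S a2 = \<ominus>\<^bsub>A\<^esub> (inv\<^bsub>A\<^esub> g2 \<otimes>\<^bsub>A\<^esub> a2)"
    unfolding D by (simp_all add: H_lift_gen[OF f])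
qed

lemmas comult_linear = algebra_homsD(1)[OF comult(1)]

lemma counit_simps:
  "\<epsilon> \<one>\<^bsub>A\<^esub> = 1"
  "\<lbrakk>x \<in> carrier A; y \<in> carrier A\<rbrakk> \<Longrightarrow> \<epsilon> (x \<otimes>\<^bsub>A\<^esub> y) = \<epsilon> x * \<epsilon> y"
  "\<lbrakk>x \<in> carrier A; y \<in> carrier A\<rbrakk> \<Longrightarrow> \<epsilon> (x \<oplus>\<^bsub>A\<^esub> y) = \<epsilon> x + \<epsilon> y"
  "x \<in> carrier A \<Longrightarrow> \<epsilon> (c \<odot>\<^bsub>A\<^esub> x) = c * \<epsilon> x"
  using algebra_homsD[OF counit(1)] linear_mapsD[OF algebra_homsD(1)[OF counit(1)]]
  by (simp_all add: base_algebra_def)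

lemma antipode_linear: "S \<in> linear_maps A A"
  using algebra_homsD(1)[OF antipode(1)] by (simp add: linear_maps_opposite)

interpretation S: linear_map A A S
  by unfold_locales (rule antipode_linear)

lemma antipode_one [simp]: "S \<one>\<^bsub>A\<^esub> = \<one>\<^bsub>A\<^esub>"
  using algebra_homsD(2)[OF antipode(1)] by simp

lemma antipode_mult: "\<lbrakk>x \<in> carrier A; y \<in> carrier A\<rbrakk> \<Longrightarrow> S (x \<otimes>\<^bsub>A\<^esub> y) = S y \<otimes>\<^bsub>A\<^esub> S x"
  using algebra_homsD(3)[OF antipode(1)] by simp

section \<open>The Hopf algebra axioms\<close>

lemma coassociative:
  assumes "x \<in> carrier A"
  shows "tensor_assoc A (tensor_map T A \<Delta> (\<lambda>a. a) (\<Delta> x)) = tensor_map A T (\<lambda>a. a) \<Delta> (\<Delta> x)"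
proof (rule H_hom_eqI[OF _ _ _ assms])
  note l = AA_TA.tensor_map_algebra_hom[OF comult(1) algebra_homs_id]
    and r = AA_AT.tensor_map_algebra_hom[OF algebra_homs_id comult(1)]
  show "(\<lambda>x. tensor_assoc A (tensor_map T A \<Delta> (\<lambda>a. a) (\<Delta> x))) \<in> algebra_homs A (tensor A T)"
    by (rule algebra_homs_comp[OF algebra_homs_comp[OF comult(1) l] A.tensor_assoc_algebra_hom])
  show "(\<lambda>x. tensor_map A T (\<lambda>a. a) \<Delta> (\<Delta> x)) \<in> algebra_homs A (tensor A T)"
    by (rule algebra_homs_comp[OF comult(1) r])
  note l_add = linear_mapsD(3)[OF algebra_homsD(1)[OF l]]
    and r_add = linear_mapsD(3)[OF algebra_homsD(1)[OF r]]
    and a_add = linear_mapsD(3)[OF algebra_homsD(1)[OF A.tensor_assoc_algebra_hom]]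
  fix y
  show "tensor_assoc A (tensor_map T A \<Delta> (\<lambda>a. a) (\<Delta> (gen y))) =
      tensor_map A T (\<lambda>a. a) \<Delta> (\<Delta> (gen y))"
    \<comment> \<open>On a generator a with group-like g both sides are a \<otimes> 1 \<otimes> 1 +
      g \<otimes> a \<otimes> 1 + g \<otimes> g \<otimes> a.\<close>
    using algebra_homsD(2)[OF comult(1)]
    by (cases y)
      (simp_all add: comult(2-) l_add r_add a_add AA_TA.tensor_map_pure AA_AT.tensor_map_pure
        comult_linear linear_maps_id TA.pure_add AT.pure_add A.tensor_assoc_pure_pure
        AA.tensor_one AT.T.a_assoc)
qed

text \<open>Multiplying by values of the counit is compatible with products because scalars are
  central; the left-hand side is thus an algebra map and is compared with the identity on
  generators.\<close>

lemma counit_left: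
  assumes "x \<in> carrier A"
  shows "tensor_lift A (\<lambda>a b. \<epsilon> a \<odot>\<^bsub>A\<^esub> b) (\<Delta> x) = x"
proof -
  let ?\<beta> = "\<lambda>a b. \<epsilon> a \<odot>\<^bsub>A\<^esub> b"
  have \<beta>: "bilinear_map A A A ?\<beta>"
    by (intro bilinear_mapI linear_mapsI)
      (simp_all add: counit_simps A.add_smult A.smult_add A.smult_smult mult.commute)
  have hom: "tensor_lift A ?\<beta> \<in> algebra_homs T A"
    by (rule AA.tensor_lift_algebra_hom[OF A.assoc_algebra_axioms \<beta>])
      (simp_all add: counit_simps A.smult_mult_left A.smult_mult_right A.smult_smult mult.commute)
  note pure = AA.tensor_lift_pure[OF A.assoc_algebra_axioms \<beta>]
    and add = linear_mapsD(3)[OF algebra_homsD(1)[OF hom]]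
  show ?thesis
  proof (rule H_hom_eqI[OF algebra_homs_comp[OF comult(1) hom] algebra_homs_id _ assms])
    show "tensor_lift A ?\<beta> (\<Delta> (gen y)) = gen y" for y
      by (cases y) (simp_all add: comult(2-) add pure counit counit_simps)
  qed
qed

lemma counit_right:
  assumes "x \<in> carrier A"
  shows "tensor_lift A (\<lambda>a b. \<epsilon> b \<odot>\<^bsub>A\<^esub> a) (\<Delta> x) = x"
proof -
  let ?\<beta> = "\<lambda>a b. \<epsilon> b \<odot>\<^bsub>A\<^esub> a"
  have \<beta>: "bilinear_map A A A ?\<beta>"
    by (intro bilinear_mapI linear_mapsI)
      (simp_all add: counit_simps A.add_smult A.smult_add A.smult_smult mult.commute)
  have hom: "tensor_lift A ?\<beta> \<in> algebra_homs T A"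
    by (rule AA.tensor_lift_algebra_hom[OF A.assoc_algebra_axioms \<beta>])
      (simp_all add: counit_simps A.smult_mult_left A.smult_mult_right A.smult_smult mult.commute)
  note pure = AA.tensor_lift_pure[OF A.assoc_algebra_axioms \<beta>]
    and add = linear_mapsD(3)[OF algebra_homsD(1)[OF hom]]
  show ?thesis
  proof (rule H_hom_eqI[OF algebra_homs_comp[OF comult(1) hom] algebra_homs_id _ assms])
    show "tensor_lift A ?\<beta> (\<Delta> (gen y)) = gen y" for y
      by (cases y) (simp_all add: comult(2-) add pure counit counit_simps)
  qed
qed

lemma antipode_left:
  assumes "x \<in> carrier A"
  shows "tensor_lift A (\<lambda>a b. S a \<otimes>\<^bsub>A\<^esub> b) (\<Delta> x) = \<epsilon> x \<odot>\<^bsub>A\<^esub> \<one>\<^bsub>A\<^esub>"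
proof -
  let ?\<beta> = "\<lambda>a b. S a \<otimes>\<^bsub>A\<^esub> b"
  let ?m = "tensor_lift A ?\<beta>"
  have \<beta>: "bilinear_map A A A ?\<beta>"
    by (intro bilinear_mapI linear_mapsI)
      (simp_all add: S.map_add S.map_smult A.l_distr A.r_distr A.smult_mult_left A.smult_mult_right)
  note pure = AA.tensor_lift_pure[OF A.assoc_algebra_axioms \<beta>]
    and lin = linear_mapsD[OF AA.tensor_lift_linear[OF A.assoc_algebra_axioms \<beta>]]
  have 1: "?m (t \<otimes>\<^bsub>T\<^esub> (a \<star> b)) = S a \<otimes>\<^bsub>A\<^esub> ?m t \<otimes>\<^bsub>A\<^esub> b"
    if "t \<in> carrier T" "a \<in> carrier A" "b \<in> carrier A" for t a b
    using that(1)
    by (induction t rule: AA.tensor_induct)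
      (use that(2,3) in \<open>simp_all add: AA.pure_mult pure antipode_mult A.m_assoc lin AA.T.l_distr
        A.l_distr A.r_distr\<close>)
  have 2: "?m (t \<otimes>\<^bsub>T\<^esub> u) = c \<odot>\<^bsub>A\<^esub> ?m u"
    if "t \<in> carrier T" "?m t = c \<odot>\<^bsub>A\<^esub> \<one>\<^bsub>A\<^esub>" "u \<in> carrier T" for t u c
    using that(3)
    by (induction u rule: AA.tensor_induct)
      (use that(1,2) in \<open>simp_all add: 1 pure lin AA.T.r_distr A.smult_mult_left A.smult_mult_right
        A.smult_add\<close>)
  show ?thesis
    using assms
  proof (induction x rule: H_induct)
    case one
    then show ?case
      by (simp add: algebra_homsD(2)[OF comult(1)] AA.tensor_one pure counit_simps)
  next
    case (gen y)
    then show ?case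
      using A.inv_closed[OF positive] A.inv_cancel[OF positive]
      by (cases y) (simp_all add: comult(2-) antipode(2-) counit lin pure A.l_neg)
  next
    case (mult x y)
    then show ?case
      by (simp add: algebra_homsD(3)[OF comult(1)] linear_mapsD(1)[OF comult_linear] 2 counit_simps
          A.smult_smult)
  next
    case (add x y)
    then show ?case
      by (simp add: linear_mapsD[OF comult_linear] lin counit_simps A.add_smult)
  next
    case (smult c x)
    then show ?case
      by (simp add: linear_mapsD[OF comult_linear] lin counit_simps A.smult_smult)
  qed
qed

text \<open>Mirror image of the previous argument: the image of the right factor now sits in the
  middle, so the induction hypothesis for y supplies the scalar.\<close>

lemma antipode_right:
  assumes "x \<in> carrier A"
  shows "tensor_lift A (\<lambda>a b. a \<otimes>\<^bsub>A\<^esub> S b) (\<Delta> x) = \<epsilon> x \<odot>\<^bsub>A\<^esub> \<one>\<^bsub>A\<^esub>"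
proof -
  let ?\<beta> = "\<lambda>a b. a \<otimes>\<^bsub>A\<^esub> S b"
  let ?m = "tensor_lift A ?\<beta>"
  have \<beta>: "bilinear_map A A A ?\<beta>"
    by (intro bilinear_mapI linear_mapsI)
      (simp_all add: S.map_add S.map_smult A.l_distr A.r_distr A.smult_mult_left A.smult_mult_right)
  note pure = AA.tensor_lift_pure[OF A.assoc_algebra_axioms \<beta>]
    and lin = linear_mapsD[OF AA.tensor_lift_linear[OF A.assoc_algebra_axioms \<beta>]]
  have 1: "?m ((a \<star> b) \<otimes>\<^bsub>T\<^esub> u) = a \<otimes>\<^bsub>A\<^esub> ?m u \<otimes>\<^bsub>A\<^esub> S b"
    if "u \<in> carrier T" "a \<in> carrier A" "b \<in> carrier A" for u a b
    using that(1)
    by (induction u rule: AA.tensor_induct)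
      (use that(2,3) in \<open>simp_all add: AA.pure_mult pure antipode_mult A.m_assoc lin AA.T.r_distr
        A.l_distr A.r_distr\<close>)
  have 2: "?m (t \<otimes>\<^bsub>T\<^esub> u) = c \<odot>\<^bsub>A\<^esub> ?m t"
    if "u \<in> carrier T" "?m u = c \<odot>\<^bsub>A\<^esub> \<one>\<^bsub>A\<^esub>" "t \<in> carrier T" for t u c
    using that(3)
    by (induction t rule: AA.tensor_induct)
      (use that(1,2) in \<open>simp_all add: 1 pure lin AA.T.l_distr A.smult_mult_left A.smult_mult_right
        A.smult_add\<close>)
  show ?thesis
    using assms
  proof (induction x rule: H_induct)
    case one
    then show ?case
      by (simp add: algebra_homsD(2)[OF comult(1)] AA.tensor_one pure counit_simps)
  next
    case (gen y)
    then show ?case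
      using A.inv_closed[OF positive] A.inv_cancel[OF positive]
      by (cases y) (simp_all add: comult(2-) antipode(2-) counit lin pure A.r_neg A.r_minus)
  next
    case (mult x y)
    then show ?case
      by (simp add: algebra_homsD(3)[OF comult(1)] linear_mapsD(1)[OF comult_linear] 2 counit_simps
          A.smult_smult mult.commute)
  next
    case (add x y)
    then show ?case
      by (simp add: linear_mapsD[OF comult_linear] lin counit_simps A.add_smult)
  next
    case (smult c x)
    then show ?case
      by (simp add: linear_mapsD[OF comult_linear] lin counit_simps A.smult_smult)
  qed
qed

lemma H_hopf_algebra: "hopf_algebra H"
  by (intro hopf_algebra.intro hopf_algebra_axioms.intro H_assoc_algebra)
    (simp_all add: comult(1) counit(1) coassociative counit_left counit_right antipode_linear
      antipode_left antipode_right)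

section \<open>The pivotal element\<close>

lemma g1_pow_anticommute:
  assumes "a \<in> {a1, a2}"
  shows "g1 [^]\<^bsub>A\<^esub> (n :: nat) \<otimes>\<^bsub>A\<^esub> a =
    (if even n then a \<otimes>\<^bsub>A\<^esub> g1 [^]\<^bsub>A\<^esub> n else \<ominus>\<^bsub>A\<^esub> (a \<otimes>\<^bsub>A\<^esub> g1 [^]\<^bsub>A\<^esub> n))"
proof -
  have a: "a \<in> carrier A" "g1 \<otimes>\<^bsub>A\<^esub> a = \<ominus>\<^bsub>A\<^esub> (a \<otimes>\<^bsub>A\<^esub> g1)"
    using assms A.g1_a1 A.g1_a2 by auto
  show ?thesis
  proof (induction n)
    case 0
    show ?case using a by simp
  next
    case (Suc n)
    have "g1 [^]\<^bsub>A\<^esub> Suc n \<otimes>\<^bsub>A\<^esub> a = \<ominus>\<^bsub>A\<^esub> (g1 [^]\<^bsub>A\<^esub> n \<otimes>\<^bsub>A\<^esub> a \<otimes>\<^bsub>A\<^esub> g1)"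
      using a by (simp add: A.m_assoc A.r_minus)
    with Suc show ?case
      using a by (simp add: A.m_assoc A.l_minus)
  qed
qed

lemma H_pivot:
  assumes "odd N"
  defines "w \<equiv> g1 [^]\<^bsub>A\<^esub> N"
  shows "pivot H w" "inv\<^bsub>A\<^esub> w = w"
proof -
  interpret \<Delta>: algebra_hom A T \<Delta>
    by (intro algebra_homI A.assoc_algebra_axioms AA.tensor_assoc_algebra comult(1))
  have w: "w \<in> carrier A"
    by (simp add: w_def)
  have ww: "w \<otimes>\<^bsub>A\<^esub> w = \<one>\<^bsub>A\<^esub>"
    \<comment> \<open>The square of w is g1 to the power 2N, which is 1 by the order
      relation.\<close>
    using A.g1_order by (simp add: w_def A.nat_pow_mult mult_2)
  then show inv_w: "inv\<^bsub>A\<^esub> w = w"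
    using w by (intro A.inv_char)
  have "\<epsilon> (g1 [^]\<^bsub>A\<^esub> (n :: nat)) = 1" for n
    by (induction n) (simp_all add: counit_simps counit)
  then have "\<epsilon> w = 1"
    by (simp add: w_def)
  moreover have "\<Delta> w = w \<star> w"
    by (simp add: w_def \<Delta>.map_nat_pow comult AA.pure_nat_pow)
  ultimately have "group_like H w"
    using w by (simp add: group_like_def)
  moreover have "S (S x) = w \<otimes>\<^bsub>A\<^esub> x \<otimes>\<^bsub>A\<^esub> w" if "x \<in> carrier A" for x
  proof (rule H_hom_eqI[OF _ _ _ that])
    note inv_closed = A.inv_closed[OF positive] and inv_simps = A.inv_simps[OF positive]
    show "(\<lambda>x. S (S x)) \<in> algebra_homs A A"
      by (intro algebra_homsI linear_mapsI) (simp_all add: S.map_add S.map_smult antipode_mult)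
    show "(\<lambda>x. w \<otimes>\<^bsub>A\<^esub> x \<otimes>\<^bsub>A\<^esub> w) \<in> algebra_homs A A"
    proof (intro algebra_homsI linear_mapsI)
      fix x y assume xy: "x \<in> carrier A" "y \<in> carrier A"
      \<comment> \<open>Since w w = 1, the two inner copies of w vanish; this makes the map x to w x
        w multiplicative.\<close>
      have "w \<otimes>\<^bsub>A\<^esub> x \<otimes>\<^bsub>A\<^esub> w \<otimes>\<^bsub>A\<^esub> (w \<otimes>\<^bsub>A\<^esub> y \<otimes>\<^bsub>A\<^esub> w) =
          w \<otimes>\<^bsub>A\<^esub> x \<otimes>\<^bsub>A\<^esub> (w \<otimes>\<^bsub>A\<^esub> w) \<otimes>\<^bsub>A\<^esub> y \<otimes>\<^bsub>A\<^esub> w"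
        using xy w by (simp add: A.m_assoc)
      then show "w \<otimes>\<^bsub>A\<^esub> (x \<otimes>\<^bsub>A\<^esub> y) \<otimes>\<^bsub>A\<^esub> w = w \<otimes>\<^bsub>A\<^esub> x \<otimes>\<^bsub>A\<^esub> w \<otimes>\<^bsub>A\<^esub> (w \<otimes>\<^bsub>A\<^esub> y \<otimes>\<^bsub>A\<^esub> w)"
        using xy w by (simp add: ww A.m_assoc)
    qed (use w in \<open>simp_all add: ww A.l_distr A.r_distr A.smult_mult_left A.smult_mult_right\<close>)
    have S_inv: "S (inv\<^bsub>A\<^esub> g1) = g1" "S (inv\<^bsub>A\<^esub> g2) = g2"
    proof -
      have "S (inv\<^bsub>A\<^esub> g) = g" if g: "g \<in> Units A" "S g = inv\<^bsub>A\<^esub> g" for g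
      proof -
        \<comment> \<open>As S reverses products and S g is the inverse of g, applying S to the
          product of that inverse with g gives the left-hand side; the result must be S 1 =
          1.\<close>
        have "inv\<^bsub>A\<^esub> g \<otimes>\<^bsub>A\<^esub> S (inv\<^bsub>A\<^esub> g) = S (inv\<^bsub>A\<^esub> g \<otimes>\<^bsub>A\<^esub> g)"
          using g by (simp add: antipode_mult A.Units_closed del: A.Units_l_inv)
        then have "g \<otimes>\<^bsub>A\<^esub> (inv\<^bsub>A\<^esub> g \<otimes>\<^bsub>A\<^esub> S (inv\<^bsub>A\<^esub> g)) = g"
          using g by (simp add: A.Units_closed)
        then show ?thesis
          using g by (simp add: A.m_assoc[symmetric] A.Units_closed)
      qed
      then show "S (inv\<^bsub>A\<^esub> g1) = g1" "S (inv\<^bsub>A\<^esub> g2) = g2"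
        using A.Units[OF positive] antipode by simp_all
    qed
    \<comment> \<open>Oddness of N enters here: g1 contributes one sign for each of its N
      factors.\<close>
    have wa: "w \<otimes>\<^bsub>A\<^esub> a1 = \<ominus>\<^bsub>A\<^esub> (a1 \<otimes>\<^bsub>A\<^esub> w)" "w \<otimes>\<^bsub>A\<^esub> a2 = \<ominus>\<^bsub>A\<^esub> (a2 \<otimes>\<^bsub>A\<^esub> w)"
      using g1_pow_anticommute[of _ N] assms(1) by (simp_all add: w_def)
    have wg: "w \<otimes>\<^bsub>A\<^esub> g1 = g1 \<otimes>\<^bsub>A\<^esub> w" "w \<otimes>\<^bsub>A\<^esub> g2 = g2 \<otimes>\<^bsub>A\<^esub> w"
    proof -
      show "w \<otimes>\<^bsub>A\<^esub> g1 = g1 \<otimes>\<^bsub>A\<^esub> w"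
        using A.nat_pow_Suc2[of g1 N] by (simp add: w_def)
      have "g1 [^]\<^bsub>A\<^esub> (n :: nat) \<otimes>\<^bsub>A\<^esub> g2 = g2 \<otimes>\<^bsub>A\<^esub> g1 [^]\<^bsub>A\<^esub> n" for n
      proof (induction n)
        case (Suc n)
        have "g1 [^]\<^bsub>A\<^esub> Suc n \<otimes>\<^bsub>A\<^esub> g2 = g1 [^]\<^bsub>A\<^esub> n \<otimes>\<^bsub>A\<^esub> g2 \<otimes>\<^bsub>A\<^esub> g1"
          by (simp add: A.m_assoc A.g1_g2)
        with Suc show ?case
          by (simp add: A.m_assoc)
      qed simp
      then show "w \<otimes>\<^bsub>A\<^esub> g2 = g2 \<otimes>\<^bsub>A\<^esub> w"
        by (simp add: w_def)
    qed
    \<comment> \<open>On a_i the square of S gives conjugation by the inverse of g_i, and each g_i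
      anticommutes with a_i, so the value is -a_i; the group elements are fixed. Conjugation by w
      has the same values.\<close>
    show "S (S (gen y)) = w \<otimes>\<^bsub>A\<^esub> gen y \<otimes>\<^bsub>A\<^esub> w" for y
      using w inv_closed
      by (cases y) (simp_all add: antipode S_inv antipode_mult S.map_uminus wa wg A.m_assoc ww
          A.l_minus inv_simps A.reorder)
  qed
  ultimately show "pivot H w"
    by (simp add: pivot_def inv_w)
qed

end

theorem lemma7p1:
  fixes l1 l2 l3 :: "'k :: {alg_closed_field, field_char_0}" and N M :: nat
  assumes "N \<ge> 2" and "M \<ge> 2" and "odd N"
  shows "spherical_hopf_algebra TYPE('v) (H_lambda N M l1 l2 l3)
    (H_gen N M l1 l2 l3 G1 [^]\<^bsub>H_lambda N M l1 l2 l3\<^esub> N)"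
proof -
  have positive: "N > 0" "M > 0"
    using assms by simp_all
  \<comment> \<open>As w is its own inverse, the two traces in the spherical condition are literally
    the same expression, whatever the module and the endomorphism.\<close>
  show ?thesis
    unfolding spherical_hopf_algebra_def
    using H_hopf_algebra[OF positive, of l1 l2 l3] H_pivot[OF positive assms(3), of l1 l2 l3]
    by (simp add: H_inv[OF positive] H_nat_pow[OF positive])
qed

end
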